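(* Let $\mathrm{k}$ be a field of characteristic zero and let $a,b,c$ be positive integers. Let \[ \mathfrak{n}_{a,b,c}= \left\{ \begin{pmatrix} 0 & A & B\\ 0 & 0 & C\\ 0& 0 & 0 \end{pmatrix} : A \in M_{a,b}(\mathrm{k}),\ B \in M_{a,c}(\mathrm{k}),\ C \in M_{b,c}(\mathrm{k})\right\}, \] a Lie algebra of $(a+b+c)\times(a+b+c)$ matrices under the commutator. If either $b=a+c$, or $a=c$ and $b\le 2a$, then \[ \mu(\mathfrak{n}_{a,b,c}) = a+b+c . \]
   Context: All Lie algebras and representations are finite dimensional over $\mathrm{k}$. For a Lie algebra $\mathfrak{n}$, $\mu(\mathfrak{n})=\min\{\dim V : (\pi,V)\text{ is a faithful representation of }\mathfrak{n}\}$. $M_{r,s}(\mathrm{k})$ denotes the space of $r\times s$ matrices over $\mathrm{k}$. *)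

theory Defs
  imports "Jordan_Normal_Form.VS_Connect"
begin

record ('k, 'l) lie_struct = "('k, 'l) module" +
  lie_bracket :: "'l \<Rightarrow> 'l \<Rightarrow> 'l"

locale lie_algebra = vectorspace "class_ring :: 'k::field ring" L
  for L :: "('k::field, 'l, 'm) lie_struct_scheme" +
  assumes finite_dimensional: "fin_dim"
    and bracket_closed:
      "\<lbrakk>x \<in> carrier L; y \<in> carrier L\<rbrakk> \<Longrightarrow> lie_bracket L x y \<in> carrier L"
    and bracket_add_left:
      "\<lbrakk>x \<in> carrier L; y \<in> carrier L; z \<in> carrier L\<rbrakk> \<Longrightarrow>
        lie_bracket L (x \<oplus>\<^bsub>L\<^esub> y) z = lie_bracket L x z \<oplus>\<^bsub>L\<^esub> lie_bracket L y z"
    and bracket_add_right: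
      "\<lbrakk>x \<in> carrier L; y \<in> carrier L; z \<in> carrier L\<rbrakk> \<Longrightarrow>
        lie_bracket L x (y \<oplus>\<^bsub>L\<^esub> z) = lie_bracket L x y \<oplus>\<^bsub>L\<^esub> lie_bracket L x z"
    and bracket_smult_left:
      "\<lbrakk>x \<in> carrier L; y \<in> carrier L\<rbrakk> \<Longrightarrow>
        lie_bracket L (k \<odot>\<^bsub>L\<^esub> x) y = k \<odot>\<^bsub>L\<^esub> lie_bracket L x y"
    and bracket_smult_right:
      "\<lbrakk>x \<in> carrier L; y \<in> carrier L\<rbrakk> \<Longrightarrow>
        lie_bracket L x (k \<odot>\<^bsub>L\<^esub> y) = k \<odot>\<^bsub>L\<^esub> lie_bracket L x y"
    and bracket_self:
      "x \<in> carrier L \<Longrightarrow> lie_bracket L x x = \<zero>\<^bsub>L\<^esub>"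
    and jacobi:
      "\<lbrakk>x \<in> carrier L; y \<in> carrier L; z \<in> carrier L\<rbrakk> \<Longrightarrow>
        lie_bracket L x (lie_bracket L y z) \<oplus>\<^bsub>L\<^esub> lie_bracket L y (lie_bracket L z x)
          \<oplus>\<^bsub>L\<^esub> lie_bracket L z (lie_bracket L x y) = \<zero>\<^bsub>L\<^esub>"

text \<open>Only the values of \<open>\<pi> x\<close> on \<open>carrier V\<close> are meaningful, so identities between
  endomorphisms of \<open>V\<close> are stated pointwise on the carrier.\<close>

locale lie_representation =
  L: lie_algebra L + V: vectorspace "class_ring :: 'k::field ring" V
  for L :: "('k::field, 'l, 'm) lie_struct_scheme"
    and V :: "('k, 'v, 'n) module_scheme"
    and \<pi> :: "'l \<Rightarrow> 'v \<Rightarrow> 'v" +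
  assumes finite_dimensional: "V.fin_dim"
    and linear: "x \<in> carrier L \<Longrightarrow> linear_map class_ring V V (\<pi> x)"
    and rep_add:
      "\<lbrakk>x \<in> carrier L; y \<in> carrier L; v \<in> carrier V\<rbrakk> \<Longrightarrow>
        \<pi> (x \<oplus>\<^bsub>L\<^esub> y) v = \<pi> x v \<oplus>\<^bsub>V\<^esub> \<pi> y v"
    and rep_smult:
      "\<lbrakk>x \<in> carrier L; v \<in> carrier V\<rbrakk> \<Longrightarrow> \<pi> (k \<odot>\<^bsub>L\<^esub> x) v = k \<odot>\<^bsub>V\<^esub> \<pi> x v"
    and rep_bracket:
      "\<lbrakk>x \<in> carrier L; y \<in> carrier L; v \<in> carrier V\<rbrakk> \<Longrightarrow>
        \<pi> (lie_bracket L x y) v = \<pi> x (\<pi> y v) \<ominus>\<^bsub>V\<^esub> \<pi> y (\<pi> x v)"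

locale faithful_lie_representation = lie_representation +
  assumes faithful:
    "\<lbrakk>x \<in> carrier L; y \<in> carrier L; \<And>v. v \<in> carrier V \<Longrightarrow> \<pi> x v = \<pi> y v\<rbrakk> \<Longrightarrow> x = y"

text \<open>HOL cannot quantify over the type of the elements of \<open>V\<close> inside a definition. The minimum
  therefore ranges over all (abstract) vector spaces whose elements have type \<open>'k vec\<close>; every
  finite dimensional space is isomorphic to one of these, and \<open>lie_mu_le\<close> below shows that
  spaces over other types do not lower the minimum. As an infimum in \<open>nat\<close>, a nonzero value
  is attained.\<close>

definition lie_mu :: "('k::field, 'l, 'm) lie_struct_scheme \<Rightarrow> nat" where
  "lie_mu L = Inf {vectorspace.dim class_ring V | (V :: ('k, 'k vec) module) \<pi>.
     faithful_lie_representation L V \<pi>}"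


text \<open>Every finite dimensional space is isomorphic to a coordinate space.\<close>

lemma exists_coordinates:
  fixes V :: "('k::field, 'v, 'n) module_scheme"
  assumes V: "vectorspace class_ring V" and fin: "vectorspace.fin_dim class_ring V"
  shows "\<exists>S. linear_map class_ring (module_vec TYPE('k) (vectorspace.dim class_ring V)) V S \<and>
    bij_betw S (carrier_vec (vectorspace.dim class_ring V)) (carrier V)"
proof -
  interpret V: vectorspace class_ring V by fact
  obtain B where B: "finite B" "V.basis B" using V.finite_basis_exists[OF fin] by auto
  then have BV: "B \<subseteq> carrier V" by (simp add: V.basis_def)
  define d where "d = V.dim"
  have "card B = d" using V.dim_basis[OF B] by (simp add: d_def)
  then obtain e where e: "bij_betw e B {0..<d}"
    using ex_bij_betw_finite_nat[OF B(1)] by auto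
  have e_less: "e v < d" if "v \<in> B" for v using e that by (auto simp: bij_betw_def)
  interpret W: vec_space "TYPE('k)" d .
  define S where "S w = V.lincomb (\<lambda>v. w $ e v) B" for w
  have S: "S w \<in> carrier V" for w unfolding S_def using BV by (intro V.lincomb_closed) auto
  have hom: "S \<in> LinearCombinations.module_hom class_ring (module_vec TYPE('k) d) V"
    unfolding LinearCombinations.module_hom_def
  proof (safe intro!: S)
    fix v w assume "v \<in> carrier (module_vec TYPE('k) d)" "w \<in> carrier (module_vec TYPE('k) d)"
    then have vw: "v \<in> carrier_vec d" "w \<in> carrier_vec d" by auto
    have "S (v + w) = V.lincomb (\<lambda>u. v $ e u + w $ e u) B"
      unfolding S_def V.lincomb_def using BV vw e_less by (intro V.finsum_cong') auto
    also have "\<dots> = (\<Oplus>\<^bsub>V\<^esub>u\<in>B. (v $ e u) \<odot>\<^bsub>V\<^esub> u \<oplus>\<^bsub>V\<^esub> (w $ e u) \<odot>\<^bsub>V\<^esub> u)"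
      unfolding V.lincomb_def using BV V.smult_l_distr by (intro V.finsum_cong') auto
    also have "\<dots> = S v \<oplus>\<^bsub>V\<^esub> S w"
      unfolding S_def V.lincomb_def using BV by (intro V.finsum_addf) auto
    finally show "S (v \<oplus>\<^bsub>module_vec TYPE('k) d\<^esub> w) = S v \<oplus>\<^bsub>V\<^esub> S w" by (simp add: module_vec_simps)
  next
    fix k :: 'k and w assume "w \<in> carrier (module_vec TYPE('k) d)"
    then have w: "w \<in> carrier_vec d" by auto
    have "S (k \<cdot>\<^sub>v w) = (\<Oplus>\<^bsub>V\<^esub>u\<in>B. k \<odot>\<^bsub>V\<^esub> ((w $ e u) \<odot>\<^bsub>V\<^esub> u))"
      unfolding S_def V.lincomb_def using BV w e_less V.smult_assoc1
      by (intro V.finsum_cong') auto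
    also have "\<dots> = k \<odot>\<^bsub>V\<^esub> S w"
      unfolding S_def V.lincomb_def using BV B(1) by (intro V.finsum_smult[symmetric]) auto
    finally show "S (k \<odot>\<^bsub>module_vec TYPE('k) d\<^esub> w) = k \<odot>\<^bsub>V\<^esub> S w" by (simp add: module_vec_simps)
  qed
  have crit: "\<exists>!a. a \<in> B \<rightarrow>\<^sub>E UNIV \<and> V.lincomb a B = v" if "v \<in> carrier V" for v
    using V.basis_criterion[OF B(1) BV] B(2) that by auto
  have lc: "V.lincomb (restrict f B) B = V.lincomb f B" for f
    unfolding V.lincomb_def using BV by (intro V.finsum_cong') auto
  have "bij_betw S (carrier_vec d) (carrier V)"
  proof (rule bij_betw_imageI)
    show "inj_on S (carrier_vec d)"
    proof (rule inj_onI)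
      fix v w assume vw: "v \<in> carrier_vec d" "w \<in> carrier_vec d" and "S v = S w"
      then have "restrict (\<lambda>u. v $ e u) B = restrict (\<lambda>u. w $ e u) B"
        using crit[OF S[of w]] by (metis (no_types, lifting) S_def lc restrict_PiE_iff UNIV_I)
      then have eq: "v $ e u = w $ e u" if "u \<in> B" for u using that by (metis restrict_apply')
      show "v = w"
      proof (rule eq_vecI)
        fix i assume "i < dim_vec w"
        then have "i \<in> e ` B" using e vw by (auto simp: bij_betw_def)
        then show "v $ i = w $ i" using eq by auto
      qed (use vw in auto)
    qed
    have "v \<in> S ` carrier_vec d" if v: "v \<in> carrier V" for v
    proof -
      obtain f where f: "V.lincomb f B = v" using crit[OF v] by auto
      let ?w = "vec d (\<lambda>i. f (inv_into B e i))"
      have "S ?w = V.lincomb f B"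
        unfolding S_def V.lincomb_def using BV e_less e
        by (intro V.finsum_cong') (auto simp: bij_betw_def)
      then show ?thesis using f by (intro image_eqI[of _ _ ?w]) auto
    qed
    then show "S ` carrier_vec d = carrier V" using S by auto
  qed
  moreover have "linear_map class_ring (module_vec TYPE('k) d) V S"
    by (unfold_locales) (rule hom)
  ultimately show ?thesis unfolding d_def by blast
qed

lemma lie_mu_le:
  fixes L :: "('k::field, 'l, 'm) lie_struct_scheme" and V :: "('k, 'v, 'n) module_scheme"
  assumes "faithful_lie_representation L V \<pi>"
  shows "lie_mu L \<le> vectorspace.dim class_ring V"
proof -
  interpret R: faithful_lie_representation L V \<pi> by fact
  define d where "d = R.V.dim"
  obtain S where S: "linear_map class_ring (module_vec TYPE('k) d) V S"
      and bij: "bij_betw S (carrier_vec d) (carrier V)"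
    using exists_coordinates[OF R.V.vectorspace_axioms R.finite_dimensional] by (auto simp: d_def)
  interpret W: vec_space "TYPE('k)" d .
  interpret S: linear_map class_ring "module_vec TYPE('k) d" V S by fact
  define T where "T = inv_into (carrier_vec d) S"
  have Tc: "T v \<in> carrier_vec d" if "v \<in> carrier V" for v
    using bij that unfolding T_def by (metis bij_betw_def inv_into_into)
  have ST: "S (T v) = v" if "v \<in> carrier V" for v
    using bij that unfolding T_def by (metis bij_betw_def f_inv_into_f)
  have Sc: "S w \<in> carrier V" if "w \<in> carrier_vec d" for w
    using bij that by (auto simp: bij_betw_def)
  have TS: "T (S w) = w" if "w \<in> carrier_vec d" for w
    using bij that unfolding T_def by (simp add: bij_betw_def)
  have S_add: "S (v + w) = S v \<oplus>\<^bsub>V\<^esub> S w" if "v \<in> carrier_vec d" "w \<in> carrier_vec d" for v w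
    using S.f_add[of v w] that by (simp add: module_vec_simps)
  have S_smult: "S (k \<cdot>\<^sub>v w) = k \<odot>\<^bsub>V\<^esub> S w" if "w \<in> carrier_vec d" for k w
    using S.f_smult[of k w] that by (simp add: module_vec_simps)
  have T_add: "T (v \<oplus>\<^bsub>V\<^esub> w) = T v + T w" if "v \<in> carrier V" "w \<in> carrier V" for v w
    using TS[of "T v + T w"] S_add[of "T v" "T w"] ST Tc that by simp
  have T_smult: "T (k \<odot>\<^bsub>V\<^esub> v) = k \<cdot>\<^sub>v T v" if "v \<in> carrier V" for k v
    using TS[of "k \<cdot>\<^sub>v T v"] S_smult[of "T v"] ST Tc that by simp
  have \<pi>c: "\<pi> x v \<in> carrier V" if "x \<in> carrier L" "v \<in> carrier V" for x v
    using mod_hom.f_im[OF linear_map.axioms(3)[OF R.linear[OF that(1)]] that(2)] .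
  have \<pi>_add: "\<pi> x (v \<oplus>\<^bsub>V\<^esub> w) = \<pi> x v \<oplus>\<^bsub>V\<^esub> \<pi> x w"
    if "x \<in> carrier L" "v \<in> carrier V" "w \<in> carrier V" for x v w
    using LinearCombinations.module_hom_add[OF mod_hom.f_hom[OF linear_map.axioms(3)[OF R.linear[OF that(1)]]] that(2,3)] .
  have \<pi>_smult: "\<pi> x (k \<odot>\<^bsub>V\<^esub> v) = k \<odot>\<^bsub>V\<^esub> \<pi> x v"
    if "x \<in> carrier L" "v \<in> carrier V" for x v k
    using LinearCombinations.module_hom_smult[OF mod_hom.f_hom[OF linear_map.axioms(3)[OF R.linear[OF that(1)]]] _ that(2), of k] by simp
  define \<rho> where "\<rho> x w = T (\<pi> x (S w))" for x w
  have minus_V: "v \<ominus>\<^bsub>V\<^esub> w = v \<oplus>\<^bsub>V\<^esub> (- 1) \<odot>\<^bsub>V\<^esub> w" if "w \<in> carrier V" for v w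
    using R.V.smult_minus_1[OF that] by (simp add: a_minus_def class_ring_simps)
  have minus_W: "v \<ominus>\<^bsub>module_vec TYPE('k) d\<^esub> w = v + (- 1) \<cdot>\<^sub>v w" if "w \<in> carrier_vec d" for v w
    using W.smult_minus_1[of w] that by (simp add: a_minus_def class_ring_simps module_vec_simps)
  have "faithful_lie_representation L (module_vec TYPE('k) d) \<rho>"
  proof (intro faithful_lie_representation.intro lie_representation.intro
      lie_representation_axioms.intro faithful_lie_representation_axioms.intro)
    show "lie_algebra L" by (rule R.L.lie_algebra_axioms)
    show "vectorspace class_ring (module_vec TYPE('k) d)" by (rule W.vectorspace_axioms)
    show "W.fin_dim" by simp
  next
    fix x assume x: "x \<in> carrier L"
    have "\<rho> x \<in> LinearCombinations.module_hom class_ring (module_vec TYPE('k) d) (module_vec TYPE('k) d)"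
      unfolding LinearCombinations.module_hom_def \<rho>_def using x
      by (auto simp: module_vec_simps Tc Sc \<pi>c S_add S_smult \<pi>_add \<pi>_smult T_add T_smult)
    then show "linear_map class_ring (module_vec TYPE('k) d) (module_vec TYPE('k) d) (\<rho> x)"
      by unfold_locales
  next
    fix x y w assume *: "x \<in> carrier L" "y \<in> carrier L" "w \<in> carrier (module_vec TYPE('k) d)"
    then show "\<rho> (x \<oplus>\<^bsub>L\<^esub> y) w = \<rho> x w \<oplus>\<^bsub>module_vec TYPE('k) d\<^esub> \<rho> y w"
      by (auto simp: \<rho>_def module_vec_simps R.rep_add Sc \<pi>c T_add)
    show "\<rho> (lie_bracket L x y) w =
        \<rho> x (\<rho> y w) \<ominus>\<^bsub>module_vec TYPE('k) d\<^esub> \<rho> y (\<rho> x w)"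
      using * by (auto simp: \<rho>_def module_vec_simps R.rep_bracket Sc Tc ST \<pi>c T_add T_smult
          minus_V minus_W)
  next
    fix x w and k :: 'k assume "x \<in> carrier L" "w \<in> carrier (module_vec TYPE('k) d)"
    then show "\<rho> (k \<odot>\<^bsub>L\<^esub> x) w = k \<odot>\<^bsub>module_vec TYPE('k) d\<^esub> \<rho> x w"
      by (auto simp: \<rho>_def module_vec_simps R.rep_smult Sc \<pi>c T_smult)
  next
    fix x y assume xy: "x \<in> carrier L" "y \<in> carrier L"
      and eq: "\<And>w. w \<in> carrier (module_vec TYPE('k) d) \<Longrightarrow> \<rho> x w = \<rho> y w"
    show "x = y"
    proof (rule R.faithful[OF xy])
      fix v assume v: "v \<in> carrier V"
      have "S (\<rho> x (T v)) = S (\<rho> y (T v))" using eq[of "T v"] Tc[OF v] by simp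
      then show "\<pi> x v = \<pi> y v" by (simp add: \<rho>_def ST v \<pi>c xy)
    qed
  qed
  then have "W.dim \<in> {vectorspace.dim class_ring V | (V :: ('k, 'k vec) module) \<pi>.
      faithful_lie_representation L V \<pi>}" by blast
  then have "lie_mu L \<le> W.dim" unfolding lie_mu_def by (intro cInf_lower) auto
  then show ?thesis using W.dim_is_n by (simp only: d_def)
qed

definition block_mat :: "nat \<Rightarrow> nat \<Rightarrow> nat \<Rightarrow> 'k::zero mat \<Rightarrow> 'k mat \<Rightarrow> 'k mat \<Rightarrow> 'k mat" where
  "block_mat a b c A B C =
     four_block_mat
       (four_block_mat (0\<^sub>m a a) A
                       (0\<^sub>m b a) (0\<^sub>m b b)) (B @\<^sub>r C)
       (0\<^sub>m c (a + b))                     (0\<^sub>m c c)"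

definition n_lie :: "nat \<Rightarrow> nat \<Rightarrow> nat \<Rightarrow> ('k::field, 'k mat) lie_struct" where
  "n_lie a b c = \<lparr>
     carrier = {block_mat a b c A B C | A B C.
       A \<in> carrier_mat a b \<and> B \<in> carrier_mat a c \<and> C \<in> carrier_mat b c},
     mult = (*),
     one = 1\<^sub>m (a + b + c),
     zero = 0\<^sub>m (a + b + c) (a + b + c),
     add = (+),
     smult = (\<cdot>\<^sub>m),
     lie_bracket = (\<lambda>X Y. X * Y - Y * X)\<rparr>"

lemma n_lie_simps [simp]:
  "zero (n_lie a b c) = 0\<^sub>m (a + b + c) (a + b + c)"
  "add (n_lie a b c) = (+)"
  "smult (n_lie a b c) = (\<cdot>\<^sub>m)"
  "lie_bracket (n_lie a b c) = (\<lambda>X Y. X * Y - Y * X)"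
  by (simp_all add: n_lie_def)

definition n_support :: "nat \<Rightarrow> nat \<Rightarrow> nat \<Rightarrow> nat \<Rightarrow> nat \<Rightarrow> bool" where
  "n_support a b c i j \<longleftrightarrow> i < a \<and> a \<le> j \<and> j < a + b + c \<or> a \<le> i \<and> i < a + b \<and> a + b \<le> j \<and> j < a + b + c"

lemma block_mat_carrier:
  assumes "A \<in> carrier_mat a b" "B \<in> carrier_mat a c" "C \<in> carrier_mat b c"
  shows "block_mat a b c A B C \<in> carrier_mat (a + b + c) (a + b + c)"
  using assms unfolding block_mat_def append_rows_def
  by (intro carrier_matI) auto

lemma block_mat_index:
  assumes "A \<in> carrier_mat a b" "B \<in> carrier_mat a c" "C \<in> carrier_mat b c"
    and "i < a + b + c" "j < a + b + c"
  shows "block_mat a b c A B C $$ (i, j) =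
    (if i < a \<and> a \<le> j \<and> j < a + b then A $$ (i, j - a)
     else if i < a \<and> a + b \<le> j then B $$ (i, j - (a + b))
     else if a \<le> i \<and> i < a + b \<and> a + b \<le> j then C $$ (i - a, j - (a + b))
     else 0)"
proof -
  note [simp] = carrier_matD[OF assms(1)] carrier_matD[OF assms(2)] carrier_matD[OF assms(3)]
  show ?thesis
    using assms(4,5) unfolding block_mat_def append_rows_def by auto
qed

lemma n_lie_carrier_iff:
  fixes X :: "'k::field mat"
  shows "X \<in> carrier (n_lie a b c) \<longleftrightarrow> X \<in> carrier_mat (a + b + c) (a + b + c) \<and>
    (\<forall>i<a + b + c. \<forall>j<a + b + c. \<not> n_support a b c i j \<longrightarrow> X $$ (i, j) = 0)"
    (is "?l \<longleftrightarrow> ?r")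
proof
  assume ?l
  then obtain A B C where X: "X = block_mat a b c A B C"
    and c: "A \<in> carrier_mat a b" "B \<in> carrier_mat a c" "C \<in> carrier_mat b c"
    by (auto simp: n_lie_def)
  show ?r unfolding X
    using block_mat_carrier[OF c] by (auto simp: block_mat_index[OF c] n_support_def)
next
  assume r: ?r
  define A where "A = mat a b (\<lambda>(i, j). X $$ (i, a + j))"
  define B where "B = mat a c (\<lambda>(i, j). X $$ (i, a + b + j))"
  define C where "C = mat b c (\<lambda>(i, j). X $$ (a + i, a + b + j))"
  have c: "A \<in> carrier_mat a b" "B \<in> carrier_mat a c" "C \<in> carrier_mat b c"
    by (auto simp: A_def B_def C_def)
  note d = carrier_matD[OF block_mat_carrier[OF c]]
  have "X = block_mat a b c A B C"
  proof (rule eq_matI)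
    fix i j assume "i < dim_row (block_mat a b c A B C)" "j < dim_col (block_mat a b c A B C)"
    then have ij: "i < a + b + c" "j < a + b + c" using d by auto
    show "X $$ (i, j) = block_mat a b c A B C $$ (i, j)"
      unfolding block_mat_index[OF c ij]
      using r ij by (auto simp: A_def B_def C_def n_support_def)
  qed (use r d in auto)
  then show ?l using c by (auto simp: n_lie_def)
qed

lemma n_lie_carrierD: "X \<in> carrier (n_lie a b c) \<Longrightarrow> X \<in> carrier_mat (a + b + c) (a + b + c)"
  by (simp add: n_lie_carrier_iff)

lemma n_lie_vectorspace: "vectorspace class_ring (n_lie a b c :: ('k::field, 'k mat) lie_struct)"
proof -
  let ?L = "n_lie a b c :: ('k, 'k mat) lie_struct"
  note car = n_lie_carrierD
  have "abelian_group ?L"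
  proof (rule abelian_groupI)
    fix x assume x: "x \<in> carrier ?L"
    show "\<exists>y\<in>carrier ?L. y \<oplus>\<^bsub>?L\<^esub> x = \<zero>\<^bsub>?L\<^esub>"
      using x by (intro bexI[of _ "- x"]) (auto simp: n_lie_carrier_iff)
  qed (auto simp: n_lie_carrier_iff)
  then have "module class_ring ?L"
    by (intro moduleI class_cring.cring_axioms)
      (auto simp: n_lie_carrier_iff field_simps intro!: eq_matI)
  then show ?thesis
    by (simp add: vectorspace_def class_field)
qed

lemma n_lie_fin_dim:
  "vectorspace.fin_dim class_ring (n_lie a b c :: ('k::field, 'k mat) lie_struct)"
proof -
  let ?L = "n_lie a b c :: ('k, 'k mat) lie_struct"
  let ?N = "a + b + c"
  let ?W = "module_vec TYPE('k) (?N * ?N)"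
  define T :: "'k vec \<Rightarrow> 'k mat" where
    "T w = mat ?N ?N (\<lambda>(i, j). if n_support a b c i j then w $ (i * ?N + j) else 0)" for w
  have idx: "i * ?N + j < ?N * ?N" if "i < ?N" "j < ?N" for i j
  proof -
    have "i * ?N + j < Suc i * ?N" using that by simp
    also have "\<dots> \<le> ?N * ?N" using that by (intro mult_le_mono1) simp
    finally show ?thesis .
  qed
  have dv: "(i * m + j) div m = i" if "j < m" for i j m :: nat
    using that by simp
  interpret W: vec_space "TYPE('k)" "?N * ?N" .
  interpret L: vectorspace class_ring ?L by (rule n_lie_vectorspace)
  have T: "T w \<in> carrier ?L" for w
    by (auto simp: n_lie_carrier_iff T_def)
  have hom: "T \<in> LinearCombinations.module_hom class_ring ?W ?L"
    unfolding LinearCombinations.module_hom_def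
    by (auto simp: T module_vec_simps, auto simp: T_def idx intro!: eq_matI)
  interpret T: linear_map class_ring ?W ?L T
    by (unfold_locales) (rule hom)
  have "X \<in> T ` carrier ?W" if X: "X \<in> carrier ?L" for X
  proof
    let ?w = "vec (?N * ?N) (\<lambda>m. X $$ (m div ?N, m mod ?N))"
    show "?w \<in> carrier ?W" by (simp add: module_vec_simps)
    show "X = T ?w"
      using X by (intro eq_matI) (auto simp: T_def n_lie_carrier_iff idx dv)
  qed
  then have "T ` carrier ?W = carrier ?L" using T by auto
  then show ?thesis by (intro T.surj_fin_dim) auto
qed

lemma n_lie_algebra: "lie_algebra (n_lie a b c :: ('k::field, 'k mat) lie_struct)"
proof -
  let ?L = "n_lie a b c :: ('k, 'k mat) lie_struct"
  let ?N = "a + b + c"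
  note car = n_lie_carrierD
  interpret L: vectorspace class_ring ?L by (rule n_lie_vectorspace)
  show ?thesis
  proof (intro lie_algebra.intro lie_algebra_axioms.intro n_lie_vectorspace n_lie_fin_dim)
    fix X Y assume XY: "X \<in> carrier ?L" "Y \<in> carrier ?L"
    have 0: "(\<Sum>k = 0..<?N. X $$ (i, k) * Y $$ (k, j)) = 0"
      if "\<not> n_support a b c i j" "i < ?N" "j < ?N" "X \<in> carrier ?L" "Y \<in> carrier ?L" for X Y i j
    proof (rule sum.neutral, rule ballI)
      fix k assume "k \<in> {0..<?N}"
      then have "\<not> n_support a b c i k \<or> \<not> n_support a b c k j" "k < ?N"
        using that(1) by (auto simp: n_support_def)
      then show "X $$ (i, k) * Y $$ (k, j) = 0"
        using that by (auto simp: n_lie_carrier_iff)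
    qed
    show "lie_bracket ?L X Y \<in> carrier ?L"
      using car[OF XY(1)] car[OF XY(2)] 0[OF _ _ _ XY] 0[OF _ _ _ XY(2,1)]
      by (auto simp: n_lie_carrier_iff[of "_ - _"] scalar_prod_def)
  next
    fix X Y Z assume "X \<in> carrier ?L" "Y \<in> carrier ?L" "Z \<in> carrier ?L"
    then have c: "X \<in> carrier_mat ?N ?N" "Y \<in> carrier_mat ?N ?N" "Z \<in> carrier_mat ?N ?N"
      by (auto dest: car)
    note cc = mult_carrier_mat[OF c(1,2)] mult_carrier_mat[OF c(2,1)] mult_carrier_mat[OF c(1,3)]
      mult_carrier_mat[OF c(3,1)] mult_carrier_mat[OF c(2,3)] mult_carrier_mat[OF c(3,2)]
    show "lie_bracket ?L (X \<oplus>\<^bsub>?L\<^esub> Y) Z = lie_bracket ?L X Z \<oplus>\<^bsub>?L\<^esub> lie_bracket ?L Y Z"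
      using c cc by (auto simp: add_mult_distrib_mat[OF c] mult_add_distrib_mat[OF c(3,1,2)]
          intro!: eq_matI)
    show "lie_bracket ?L X (Y \<oplus>\<^bsub>?L\<^esub> Z) = lie_bracket ?L X Y \<oplus>\<^bsub>?L\<^esub> lie_bracket ?L X Z"
      using c cc by (auto simp: add_mult_distrib_mat[OF c(2,3,1)] mult_add_distrib_mat[OF c]
          intro!: eq_matI)
    have d: "U * (V * W - W * V) = U * V * W - U * W * V"
      "(V * W - W * V) * U = V * W * U - W * V * U"
      if "U \<in> carrier_mat ?N ?N" "V \<in> carrier_mat ?N ?N" "W \<in> carrier_mat ?N ?N"
      for U V W :: "'k mat"
      using that
      by (auto simp: mult_minus_distrib_mat[of _ ?N ?N _ ?N] minus_mult_distrib_mat[of _ ?N ?N _ _ ?N]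
          assoc_mult_mat[of _ ?N ?N _ ?N _ ?N])
    show "lie_bracket ?L X (lie_bracket ?L Y Z) \<oplus>\<^bsub>?L\<^esub> lie_bracket ?L Y (lie_bracket ?L Z X)
        \<oplus>\<^bsub>?L\<^esub> lie_bracket ?L Z (lie_bracket ?L X Y) = \<zero>\<^bsub>?L\<^esub>"
      using c by (auto simp: d simp del: index_mult_mat(1) intro!: eq_matI)
  next
    fix X Y k assume "X \<in> carrier ?L" "Y \<in> carrier ?L"
    then have c: "X \<in> carrier_mat ?N ?N" "Y \<in> carrier_mat ?N ?N" by (auto dest: car)
    note cc = mult_carrier_mat[OF c] mult_carrier_mat[OF c(2,1)]
    show "lie_bracket ?L (k \<odot>\<^bsub>?L\<^esub> X) Y = k \<odot>\<^bsub>?L\<^esub> lie_bracket ?L X Y"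
      and "lie_bracket ?L X (k \<odot>\<^bsub>?L\<^esub> Y) = k \<odot>\<^bsub>?L\<^esub> lie_bracket ?L X Y"
      using c cc by (auto simp: mult_smult_distrib[OF c] mult_smult_distrib[OF c(2,1)]
          mult_smult_assoc_mat[OF c] mult_smult_assoc_mat[OF c(2,1)] right_diff_distrib
          intro!: eq_matI)
  next
    fix X assume "X \<in> carrier ?L"
    then show "lie_bracket ?L X X = \<zero>\<^bsub>?L\<^esub>" by (auto dest: car)
  qed
qed

end

theory Submission
  imports Defs "HOL-Library.Function_Algebras"
begin

text \<open>
  The inclusion of the algebra into square matrices of size \<open>a + b + c\<close> is a faithful representation,
  so the content is the lower bound. Let \<open>V\<close> be a faithful representation and let \<open>J\<close> be the
  commutative unital algebra of operators generated by the centre, that is, by the operators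
  \<open>\<zeta> i l\<close> of the block \<open>B\<close>. The centre has dimension \<open>a * c\<close> and consists of sums of commutators, which have
  trace zero; hence the identity is not among them, and \<open>dim J \<ge> a * c + 1\<close>.

  Two inequalities are combined. Choose \<open>v\<close> such that \<open>J v\<close> has the largest possible dimension \<open>s\<close>, and let
  \<open>M\<close> be a subspace of codimension \<open>p\<close> that is killed by the annihilator of \<open>v\<close> in \<open>J\<close>. A refinement of Schur's argument on
  commuting matrices (\<open>schur_bound\<close>) gives \<open>a * c \<le> (s - 1) * (p + 1)\<close>. On the other hand, the operators
  \<open>x\<close> with \<open>x v \<in> J v\<close> are isotropic for every form \<open>\<phi> ([x, y] v)\<close> with \<open>\<phi>\<close> a functional on \<open>V\<close>
  (\<open>symplectic_bound\<close>). If the matrix of all \<open>\<phi> (\<zeta> i l v)\<close> has rank \<open>r\<close>, the form lives on \<open>2 * r * b\<close> operators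
  without radical, so these operators enlarge \<open>J v\<close> to some \<open>M\<close> of dimension at least \<open>s + r * b\<close>. Always
  \<open>r \<ge> 1\<close> for a suitable \<open>\<phi>\<close>, so \<open>dim V \<ge> (s - 1) + (p + 1) + b\<close>, where the product of the first two terms is
  at least \<open>a * c\<close> (\<open>zeta_alg_bound\<close>).

  For \<open>a = c\<close> the inequality of arithmetic and geometric means finishes the proof. For \<open>b = a + c\<close>, rank
  two for a single pair \<open>\<phi>\<close>, \<open>v\<close> already yields \<open>dim V \<ge> 2 * b = a + b + c\<close>. If the rank never exceeds one and
  \<open>a, c \<ge> 2\<close>, then the bilinear dependence on \<open>\<phi>\<close> and \<open>v\<close> forces \<open>\<zeta> i l = f l \<otimes> g i\<close>, or the
  same with the indices exchanged (\<open>rank_one_bound\<close>); then \<open>s - 1\<close> equals \<open>a\<close> or \<open>c\<close>, and the product inequality gives the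
  other one (\<open>factored_bound\<close>). If \<open>c = 1\<close> or \<open>a = 1\<close>, Schur's bound for the abelian ideal \<open>C = 0\<close> or \<open>A = 0\<close>
  suffices (\<open>abelian_bound\<close>).
\<close>

section \<open>Finite dimensional subspaces\<close>

text \<open>The ambient space is infinite dimensional in the application (sequences over the field), so
  dimensions are taken of subsets that lie in the span of a finite set.\<close>

locale lin_space = vector_space scale
  for scale :: "'k::field \<Rightarrow> 'v::ab_group_add \<Rightarrow> 'v" (infixr "*s" 75)
begin

definition fin_spanned :: "'v set \<Rightarrow> bool" where
  "fin_spanned S \<longleftrightarrow> (\<exists>B. finite B \<and> S \<subseteq> span B)"

lemma fin_spanned_subset: "fin_spanned T \<Longrightarrow> S \<subseteq> T \<Longrightarrow> fin_spanned S"
  unfolding fin_spanned_def by blast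

lemma fin_spanned_finite: "finite S \<Longrightarrow> fin_spanned S"
  unfolding fin_spanned_def using span_superset by blast

lemma finite_independent:
  assumes "fin_spanned S" "independent B" "B \<subseteq> S"
  shows "finite B"
  using assms independent_span_bound unfolding fin_spanned_def by (meson subset_trans)

lemma card_independent_le_dim:
  assumes "fin_spanned S" "independent B" "B \<subseteq> S"
  shows "card B \<le> dim S"
proof -
  obtain C where C: "C \<subseteq> S" "independent C" "S \<subseteq> span C" "card C = dim S"
    using basis_exists .
  then have "finite C" using finite_independent assms(1) by blast
  then show ?thesis using independent_span_bound[of C B] C assms by auto
qed

lemma dim_subset:
  assumes "fin_spanned T" "S \<subseteq> T" shows "dim S \<le> dim T"
proof -
  obtain C where C: "C \<subseteq> S" "independent C" "S \<subseteq> span C" "card C = dim S"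
    using basis_exists .
  then show ?thesis using card_independent_le_dim[OF assms(1), of C] assms(2) by auto
qed

lemma subspace_dim_ge_eq:
  assumes "fin_spanned T" "subspace S" "S \<subseteq> T" "dim T \<le> dim S" shows "S = T"
proof (rule ccontr)
  assume "S \<noteq> T"
  then obtain t where t: "t \<in> T" "t \<notin> S" using assms by auto
  obtain C where C: "C \<subseteq> S" "independent C" "S \<subseteq> span C" "card C = dim S"
    using basis_exists .
  have "finite C" using finite_independent C assms by blast
  moreover have "t \<notin> span C" using t C assms span_minimal by blast
  moreover have "t \<notin> C" using \<open>t \<notin> span C\<close> span_base by blast
  ultimately have "card (insert t C) = Suc (dim S)" "independent (insert t C)"
    using C independent_insertI[of t C] by simp_all
  then show False
    using card_independent_le_dim[OF assms(1), of "insert t C"] t C assms by auto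
qed

lemma card_family_le_dim:
  assumes "finite I" "fin_spanned S" "u ` I \<subseteq> S"
    and indep: "\<And>x. (\<Sum>i\<in>I. x i *s u i) = 0 \<Longrightarrow> \<forall>i\<in>I. x i = 0"
  shows "card I \<le> dim S"
proof -
  have inj: "inj_on u I"
  proof (rule inj_onI, rule ccontr)
    fix i j assume ij: "i \<in> I" "j \<in> I" "u i = u j" "i \<noteq> j"
    let ?x = "\<lambda>k. (if k = i then 1 else 0) - (if k = j then 1 else 0)"
    have "(\<Sum>k\<in>I. ?x k *s u k) = (\<Sum>k\<in>I. if k = i then u k else 0) - (\<Sum>k\<in>I. if k = j then u k else 0)"
      unfolding sum_subtractf[symmetric] by (rule sum.cong) (auto simp: scale_left_diff_distrib)
    also have "\<dots> = 0" using ij assms(1) by simp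
    finally show False using indep[of ?x] ij by auto
  qed
  have "independent (u ` I)"
  proof (rule independent_if_scalars_zero)
    fix f v assume f: "(\<Sum>x\<in>u ` I. f x *s x) = 0" and v: "v \<in> u ` I"
    have "(\<Sum>i\<in>I. f (u i) *s u i) = 0"
      using f by (simp add: sum.reindex[OF inj])
    then show "f v = 0" using indep[of "\<lambda>i. f (u i)"] v by auto
  qed (use assms in auto)
  then show ?thesis
    using card_independent_le_dim[OF assms(2) _ assms(3)] card_image[OF inj] by simp
qed

lemma exists_functional:
  assumes "v \<noteq> 0"
  shows "\<exists>\<phi>. Vector_Spaces.linear scale (*) \<phi> \<and> \<phi> v \<noteq> (0::'k)"
proof -
  have v: "vector_space ((*) :: 'k \<Rightarrow> 'k \<Rightarrow> 'k)" by unfold_locales (auto simp: algebra_simps)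
  interpret q: vector_space_pair scale "(*) :: 'k \<Rightarrow> 'k \<Rightarrow> 'k"
    by (intro vector_space_pair.intro v vector_space_axioms)
  obtain \<phi> where "Vector_Spaces.linear scale (*) \<phi>" "\<forall>x\<in>{v}. \<phi> x = 1"
    using q.linear_independent_extend[of "{v}" "\<lambda>_. 1"] assms by auto
  then show ?thesis by auto
qed

end

locale lin_space_pair = vs1: lin_space s1 + vs2: lin_space s2
  for s1 :: "'k::field \<Rightarrow> 'v::ab_group_add \<Rightarrow> 'v"
    and s2 :: "'k \<Rightarrow> 'w::ab_group_add \<Rightarrow> 'w"

lemma (in lin_space_pair) rank_nullity:
  assumes f: "Vector_Spaces.linear s1 s2 f" and S: "vs1.subspace S"
    and K: "vs1.fin_spanned {x \<in> S. f x = 0}" and R: "vs2.fin_spanned (f ` S)"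
  shows "vs1.fin_spanned S \<and> vs1.dim S = vs1.dim {x \<in> S. f x = 0} + vs2.dim (f ` S)"
proof -
  interpret f: Vector_Spaces.linear s1 s2 f by fact
  let ?K = "{x \<in> S. f x = 0}"
  obtain B where B: "B \<subseteq> ?K" "vs1.independent B" "?K \<subseteq> vs1.span B" "card B = vs1.dim ?K"
    using vs1.basis_exists .
  obtain C where C: "B \<subseteq> C" "C \<subseteq> S" "vs1.independent C" "S \<subseteq> vs1.span C"
    using vs1.maximal_independent_subset_extend[of B S] B by blast
  have finB: "finite B" using vs1.finite_independent[OF K] B by blast
  define D where "D = C - B"
  have DS: "vs1.span D \<subseteq> S" using C S by (intro vs1.span_minimal) (auto simp: D_def)
  have inj: "inj_on f (vs1.span D)"
  proof (rule inj_onI)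
    fix x y assume xy: "x \<in> vs1.span D" "y \<in> vs1.span D" "f x = f y"
    then have d: "x - y \<in> vs1.span D" by (simp add: vs1.span_diff)
    then have "x - y \<in> ?K" using DS xy by (auto simp: f.diff)
    then have "x - y \<in> vs1.span B" using B by auto
    moreover have "vs1.span B \<inter> vs1.span D = {0}"
    proof -
      have "z = 0" if z: "z \<in> vs1.span B" "z \<in> vs1.span D" for z
      proof -
        have r1: "vs1.representation C z = vs1.representation B z"
          using z C by (intro vs1.representation_extend) auto
        have r2: "vs1.representation C z = vs1.representation D z"
          using z C by (intro vs1.representation_extend) (auto simp: D_def)
        have "vs1.representation C z b = 0" for b
        proof (cases "b \<in> B")
          case True then show ?thesis
            unfolding r2 using vs1.representation_ne_zero[of D z b] by (auto simp: D_def)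
        next
          case False then show ?thesis
            unfolding r1 using vs1.representation_ne_zero[of B z b] by auto
        qed
        then show ?thesis
          using vs1.sum_nonzero_representation_eq[OF C(3), of z] z C vs1.span_mono[of B C] by auto
      qed
      then show ?thesis using vs1.span_zero by auto
    qed
    ultimately have "x - y = 0" using d by blast
    then show "x = y" by simp
  qed
  have indD: "vs1.independent D" using C vs1.independent_mono unfolding D_def by blast
  have ind: "vs2.independent (f ` D)"
    using f.independent_injective_image[OF indD inj] .
  have sub: "f ` D \<subseteq> f ` S" using C by (auto simp: D_def)
  have sp: "f ` S \<subseteq> vs2.span (f ` D)"
  proof
    fix y assume "y \<in> f ` S"
    then obtain x where x: "x \<in> S" "y = f x" by auto
    then have "x \<in> vs1.span (B \<union> D)" using C by (auto simp: D_def Un_absorb1)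
    then obtain p q where pq: "x = p + q" "p \<in> vs1.span B" "q \<in> vs1.span D"
      unfolding vs1.span_Un by auto
    have "f p = 0" using pq(2) by (rule f.eq_0_on_span[rotated]) (use B in auto)
    then have "y = f q" using x pq by (simp add: f.add)
    then show "y \<in> vs2.span (f ` D)" using pq by (auto simp: f.span_image)
  qed
  have "finite (f ` D)" using vs2.finite_independent[OF R ind sub] .
  then have finD: "finite D"
    using inj_on_subset[OF inj vs1.span_superset] finite_image_iff by blast
  have "card (f ` D) = vs2.dim (f ` S)" using vs2.basis_card_eq_dim[OF sub sp ind] .
  then have cD: "card D = vs2.dim (f ` S)"
    using card_image[OF inj_on_subset[OF inj vs1.span_superset]] by simp
  have "C = B \<union> D" "B \<inter> D = {}" using C by (auto simp: D_def)
  then have "finite C" "card C = card B + card D"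
    using finB finD by (auto simp: card_Un_disjoint)
  moreover have "card C = vs1.dim S" using vs1.basis_card_eq_dim C by blast
  ultimately show ?thesis
    using C B cD unfolding vs1.fin_spanned_def by auto
qed

lemma homogeneous_system:
  fixes c :: "'i \<Rightarrow> 'e \<Rightarrow> 'k::field"
  assumes "finite E" "finite I" "card E < card I"
  shows "\<exists>x. (\<exists>i\<in>I. x i \<noteq> 0) \<and> (\<forall>e\<in>E. (\<Sum>i\<in>I. x i * c i e) = 0)"
  using assms
proof (induction E arbitrary: I c rule: finite_induct)
  case empty
  then obtain i where "i \<in> I" by (metis card.empty card_gt_0_iff equals0I)
  then show ?case by (intro exI[of _ "\<lambda>_. 1"]) auto
next
  case (insert e E)
  show ?case
  proof (cases "\<forall>i\<in>I. c i e = 0")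
    case True
    then show ?thesis using insert.IH[of I c] insert by auto
  next
    case False
    then obtain i0 where i0: "i0 \<in> I" "c i0 e \<noteq> 0" by auto
    let ?I = "I - {i0}"
    have "card E < card ?I" using insert i0 by simp
    then obtain x where x: "\<exists>i\<in>?I. x i \<noteq> 0"
      and eq: "\<And>e'. e' \<in> E \<Longrightarrow> (\<Sum>i\<in>?I. x i * (c i e' - c i e / c i0 e * c i0 e')) = 0"
      using insert.IH[of ?I "\<lambda>i e'. c i e' - c i e / c i0 e * c i0 e'"] insert.prems by blast
    define s where "s = - (\<Sum>i\<in>?I. x i * c i e) / c i0 e"
    define y where "y = x(i0 := s)"
    have sum: "(\<Sum>i\<in>I. y i * c i e') = s * c i0 e' + (\<Sum>i\<in>?I. x i * c i e')" for e'
      unfolding y_def using i0 insert by (subst sum.remove[of _ i0]) (auto intro!: sum.cong)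
    have "(\<Sum>i\<in>I. y i * c i e') = 0" if "e' \<in> E" for e'
    proof -
      have "0 = (\<Sum>i\<in>?I. x i * c i e') - (\<Sum>i\<in>?I. x i * c i e) * (c i0 e' / c i0 e)"
        unfolding eq[OF that, symmetric] sum_distrib_right sum_subtractf[symmetric]
        by (rule sum.cong) (auto simp: algebra_simps)
      then show ?thesis unfolding sum s_def by (simp add: field_simps)
    qed
    moreover have "(\<Sum>i\<in>I. y i * c i e) = 0" unfolding sum s_def using i0 by simp
    moreover have "\<exists>i\<in>I. y i \<noteq> 0" using x by (auto simp: y_def)
    ultimately show ?thesis by auto
  qed
qed

text \<open>A linear map on a space with a nondegenerate form, given in coordinates indexed by \<open>I\<close>, has rank
  modulo \<open>W\<close> at least half of \<open>card I\<close> when the preimage of \<open>W\<close> is isotropic: if the rank \<open>d\<close> were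
  smaller, then \<open>2 * d\<close> linear conditions on \<open>x\<close> would have a nonzero solution, \<open>d\<close> of them placing
  \<open>x\<close> in the preimage and \<open>d\<close> of them making it orthogonal to a complement. Such an \<open>x\<close> is orthogonal
  to the preimage as well, hence to everything.\<close>

lemma (in lin_space) isotropic_bound:
  fixes \<omega> :: "'i \<Rightarrow> 'i \<Rightarrow> 'k"
  assumes finI: "finite I" and W: "subspace W" "fin_spanned W"
    and nondeg: "\<And>x. (\<forall>j\<in>I. (\<Sum>i\<in>I. x i * \<omega> i j) = 0) \<Longrightarrow> \<forall>i\<in>I. x i = 0"
    and iso: "\<And>x y. (\<Sum>i\<in>I. x i *s u i) \<in> W \<Longrightarrow> (\<Sum>i\<in>I. y i *s u i) \<in> W \<Longrightarrow>
      (\<Sum>i\<in>I. \<Sum>j\<in>I. x i * y j * \<omega> i j) = 0"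
  shows "card I + 2 * dim W \<le> 2 * dim (span (W \<union> u ` I))"
proof -
  obtain BW where BW: "BW \<subseteq> W" "independent BW" "W \<subseteq> span BW" "card BW = dim W"
    using basis_exists .
  have spBW: "span BW = W" using BW W by (meson span_minimal subset_antisym)
  obtain B where B: "BW \<subseteq> B" "B \<subseteq> BW \<union> u ` I" "independent B" "BW \<union> u ` I \<subseteq> span B"
    using maximal_independent_subset_extend[of BW "BW \<union> u ` I"] BW by blast
  have "B - BW \<subseteq> u ` I" using B by auto
  then obtain I0 where I0: "I0 \<subseteq> I" "inj_on u I0" "B - BW = u ` I0"
    unfolding subset_image_inj by auto
  have fin0: "finite I0" using I0 finI finite_subset by auto
  have finBW: "finite BW" using finite_independent[OF W(2) BW(2,1)] .
  have "B = BW \<union> u ` I0" "BW \<inter> u ` I0 = {}" using B I0 by auto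
  then have cB: "card B = dim W + card I0"
    using finBW fin0 BW card_image[OF I0(2)] by (simp add: card_Un_disjoint)
  have "span (W \<union> u ` I) = span B"
  proof
    have "W \<subseteq> span B" using BW B span_mono[of BW B] by auto
    then show "span (W \<union> u ` I) \<subseteq> span B" using B by (intro span_minimal) auto
    show "span B \<subseteq> span (W \<union> u ` I)" using B BW by (intro span_mono) auto
  qed
  then have dM: "dim (span (W \<union> u ` I)) = dim W + card I0"
    using B cB dim_span_eq_card_independent by simp
  have "\<exists>t. u j - (\<Sum>q\<in>I0. t q *s u q) \<in> W" if "j \<in> I" for j
  proof -
    have "u j \<in> span (BW \<union> u ` I0)" using that B \<open>B = BW \<union> u ` I0\<close> by auto
    then obtain p r where pr: "u j = p + r" "p \<in> span BW" "r \<in> span (u ` I0)"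
      unfolding span_Un by auto
    then obtain s where "r = (\<Sum>v\<in>u ` I0. s v *s v)"
      using span_finite[of "u ` I0"] fin0 by auto
    then have "r = (\<Sum>q\<in>I0. s (u q) *s u q)" by (simp add: sum.reindex[OF I0(2)])
    then show ?thesis using pr spBW by (intro exI[of _ "\<lambda>q. s (u q)"]) auto
  qed
  then obtain t where t: "\<And>j. j \<in> I \<Longrightarrow> u j - (\<Sum>q\<in>I0. t j q *s u q) \<in> W" by metis
  have "card I \<le> 2 * card I0"
  proof (rule ccontr)
    assume "\<not> card I \<le> 2 * card I0"
    then have "card (I0 <+> I0) < card I" using fin0 by (simp add: card_Plus)
    moreover have "finite (I0 <+> I0)" using fin0 by simp
    ultimately obtain x where x: "\<exists>i\<in>I. x i \<noteq> 0"
      and eq: "\<And>e. e \<in> I0 <+> I0 \<Longrightarrow> (\<Sum>i\<in>I. x i * (case e of Inl q \<Rightarrow> t i q | Inr q \<Rightarrow> \<omega> i q)) = 0"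
      using homogeneous_system[of "I0 <+> I0" I "\<lambda>i e. case e of Inl q \<Rightarrow> t i q | Inr q \<Rightarrow> \<omega> i q"]
        finI by blast
    have e1: "(\<Sum>i\<in>I. x i * t i q) = 0" if "q \<in> I0" for q using eq[of "Inl q"] that by auto
    have e2: "(\<Sum>i\<in>I. x i * \<omega> i q) = 0" if "q \<in> I0" for q using eq[of "Inr q"] that by auto
    have "(\<Sum>i\<in>I. x i *s (u i - (\<Sum>q\<in>I0. t i q *s u q))) =
        (\<Sum>i\<in>I. x i *s u i) - (\<Sum>i\<in>I. \<Sum>q\<in>I0. (x i * t i q) *s u q)"
      by (simp add: scale_right_diff_distrib sum_subtractf scale_sum_right)
    also have "(\<Sum>i\<in>I. \<Sum>q\<in>I0. (x i * t i q) *s u q) = (\<Sum>q\<in>I0. (\<Sum>i\<in>I. x i * t i q) *s u q)"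
      by (subst sum.swap) (simp add: scale_sum_left)
    also have "\<dots> = 0" using e1 by simp
    finally have "(\<Sum>i\<in>I. x i *s u i) = (\<Sum>i\<in>I. x i *s (u i - (\<Sum>q\<in>I0. t i q *s u q)))" by simp
    also have "\<dots> \<in> W" using t W by (intro subspace_sum subspace_scale) auto
    finally have xW: "(\<Sum>i\<in>I. x i *s u i) \<in> W" .
    have "(\<Sum>i\<in>I. x i * \<omega> i j) = 0" if j: "j \<in> I" for j
    proof -
      \<comment> \<open>the \<open>j\<close>-th coordinate vector, corrected by the chosen complement so that it lies in the preimage of \<open>W\<close>\<close>
      let ?y = "\<lambda>i. (if i = j then 1 else 0) - (if i \<in> I0 then t j i else 0)"
      have ysum: "(\<Sum>i\<in>I. (if i = j then f i else 0) - (if i \<in> I0 then g i else 0)) = f j - (\<Sum>q\<in>I0. g q)"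
        for f g :: "'i \<Rightarrow> 'z::ab_group_add"
        using j finI I0 by (simp add: sum_subtractf sum.If_cases Int_absorb1)
      have "(\<Sum>i\<in>I. ?y i *s u i) = (\<Sum>i\<in>I. (if i = j then u i else 0) - (if i \<in> I0 then t j i *s u i else 0))"
        by (rule sum.cong) (auto simp: scale_left_diff_distrib)
      then have "(\<Sum>i\<in>I. ?y i *s u i) = u j - (\<Sum>q\<in>I0. t j q *s u q)" by (simp only: ysum)
      then have "0 = (\<Sum>i\<in>I. \<Sum>k\<in>I. x i * ?y k * \<omega> i k)" using iso[OF xW, of ?y] t[OF j] by simp
      also have "\<dots> = (\<Sum>k\<in>I. ?y k * (\<Sum>i\<in>I. x i * \<omega> i k))"
        unfolding sum_distrib_left by (subst sum.swap) (simp only: mult.left_commute mult.assoc)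
      also have "\<dots> = (\<Sum>k\<in>I. (if k = j then (\<Sum>i\<in>I. x i * \<omega> i k) else 0) -
          (if k \<in> I0 then t j k * (\<Sum>i\<in>I. x i * \<omega> i k) else 0))"
        by (rule sum.cong) (auto simp: algebra_simps)
      also have "\<dots> = (\<Sum>i\<in>I. x i * \<omega> i j) - (\<Sum>q\<in>I0. t j q * (\<Sum>i\<in>I. x i * \<omega> i q))"
        by (rule ysum)
      also have "\<dots> = (\<Sum>i\<in>I. x i * \<omega> i j)" using e2 by simp
      finally show ?thesis by simp
    qed
    then show False using nondeg[of x] x by auto
  qed
  then show ?thesis using dM by simp
qed

section \<open>Endomorphisms of a finite dimensional space\<close>

text \<open>A finite dimensional space is modelled as the range of an idempotent \<open>P\<close>. Its endomorphisms are
  the linear maps of the ambient space that satisfy \<open>P \<circ> f = f = f \<circ> P\<close>; they form a vector space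
  under the pointwise operations, closed under composition, and \<open>P\<close> is the identity.\<close>

locale projection = lin_space scale
  for scale :: "'k::field \<Rightarrow> 'v::ab_group_add \<Rightarrow> 'v" (infixr "*s" 75) +
  fixes P :: "'v \<Rightarrow> 'v"
  assumes linear_P: "Vector_Spaces.linear scale scale P"
    and P_P: "P (P v) = P v"
    and fin_range: "fin_spanned (range P)"
begin

sublocale ops: lin_space "\<lambda>c f x. c *s f x :: 'v"
  by unfold_locales (auto simp: fun_eq_iff algebra_simps scale_right_distrib scale_left_distrib)

sublocale eval: lin_space_pair "\<lambda>c f x. c *s f x :: 'v" scale ..

sublocale self: lin_space_pair scale scale ..

definition Endo :: "('v \<Rightarrow> 'v) set" where
  "Endo = {f. Vector_Spaces.linear scale scale f \<and> (\<forall>v. P (f v) = f v) \<and> (\<forall>v. f (P v) = f v)}"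

lemma linear_eval: "Vector_Spaces.linear (\<lambda>c f x. c *s f x :: 'v) scale (\<lambda>f. f w)"
  unfolding Vector_Spaces.linear_iff by (auto intro: ops.vector_space_axioms vector_space_axioms)

lemma sum_apply: "(\<Sum>i\<in>I. g i) w = (\<Sum>i\<in>I. g i w)" for g :: "'i \<Rightarrow> 'v \<Rightarrow> 'v"
  by (induction I rule: infinite_finite_induct) auto

lemma range_P_iff: "v \<in> range P \<longleftrightarrow> P v = v"
  using P_P by (metis rangeE rangeI)

lemma subspace_range: "subspace (range P)"
  using linear_P by (metis Vector_Spaces.linear.axioms(3) module_hom.subspace_image subspace_UNIV)

lemma Endo_linear: "f \<in> Endo \<Longrightarrow> Vector_Spaces.linear scale scale f"
  and Endo_range: "f \<in> Endo \<Longrightarrow> f v \<in> range P"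
  and Endo_P: "f \<in> Endo \<Longrightarrow> f (P v) = f v"
  by (auto simp: Endo_def range_P_iff)

lemma Endo_add: "f \<in> Endo \<Longrightarrow> f (v + w) = f v + f w"
  and Endo_scale: "f \<in> Endo \<Longrightarrow> f (c *s v) = c *s f v"
  by (auto simp: Endo_def Vector_Spaces.linear_iff)

lemma Endo_zero: "f \<in> Endo \<Longrightarrow> f 0 = 0"
  using Endo_scale[of f 0 0] by simp

lemma Endo_neg: "f \<in> Endo \<Longrightarrow> f (- v) = - f v"
  using Endo_add[of f v "-v"] Endo_zero[of f] by (simp add: eq_neg_iff_add_eq_0 add.commute)

lemma Endo_diff: "f \<in> Endo \<Longrightarrow> f (v - w) = f v - f w"
  using Endo_add[of f v "-w"] Endo_neg by simp

lemma Endo_sum: "f \<in> Endo \<Longrightarrow> f (\<Sum>i\<in>I. g i) = (\<Sum>i\<in>I. f (g i))"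
  by (induction I rule: infinite_finite_induct) (auto simp: Endo_add Endo_zero)

lemma Endo_I:
  assumes "\<And>v w. f (v + w) = f v + f w" "\<And>c v. f (c *s v) = c *s f v"
    "\<And>v. P (f v) = f v" "\<And>v. f (P v) = f v"
  shows "f \<in> Endo"
  using assms by (auto simp: Endo_def Vector_Spaces.linear_iff intro: vector_space_axioms)

lemma P_add: "P (v + w) = P v + P w" and P_scale: "P (c *s v) = c *s P v"
  using linear_P by (auto simp: Vector_Spaces.linear_iff)

lemma P_Endo: "P \<in> Endo"
  by (rule Endo_I) (auto simp: P_add P_scale P_P)

lemma P_Endo_apply: "f \<in> Endo \<Longrightarrow> P (f v) = f v"
  by (simp add: Endo_def)

lemma subspace_Endo: "ops.subspace Endo"
  unfolding ops.subspace_def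
proof (intro conjI allI ballI)
  show "0 \<in> Endo" using P_scale[of 0 0] by (intro Endo_I) auto
  fix f g assume "f \<in> Endo" "g \<in> Endo"
  then show "f + g \<in> Endo"
    by (intro Endo_I) (auto simp: Endo_add Endo_scale P_add P_Endo_apply Endo_P scale_right_distrib)
next
  fix c f assume "f \<in> Endo"
  then show "(\<lambda>x. c *s f x) \<in> Endo"
    by (intro Endo_I) (auto simp: Endo_add Endo_scale P_scale P_Endo_apply Endo_P scale_right_distrib mult.commute)
qed

lemma comp_Endo: "f \<in> Endo \<Longrightarrow> g \<in> Endo \<Longrightarrow> f \<circ> g \<in> Endo"
  by (rule Endo_I) (auto simp: Endo_add Endo_scale P_Endo_apply Endo_P)

text \<open>Rank-nullity for evaluation at one vector after the other.\<close>

lemma dim_annihilator: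
  assumes "finite W" "ops.subspace K" "K \<subseteq> Endo"
    and "\<And>w. dim ((\<lambda>f. f w) ` K) \<le> t"
    and "ops.fin_spanned {f \<in> K. \<forall>w\<in>W. f w = 0}"
  shows "ops.fin_spanned K \<and> ops.dim K \<le> t * card W + ops.dim {f \<in> K. \<forall>w\<in>W. f w = 0}"
  using assms
proof (induction W arbitrary: K rule: finite_induct)
  case (insert w W)
  let ?K = "{f \<in> K. f w = 0}"
  have eq: "{f \<in> ?K. \<forall>w\<in>W. f w = 0} = {f \<in> K. \<forall>w\<in>insert w W. f w = 0}" by auto
  have sub: "ops.subspace ?K"
    using insert.prems(1) by (auto simp: ops.subspace_def)
  have dims: "dim ((\<lambda>f. f w') ` ?K) \<le> t" for w'
  proof -
    have "fin_spanned ((\<lambda>f. f w') ` K)"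
      using insert.prems(2) by (intro fin_spanned_subset[OF fin_range]) (auto intro: Endo_range)
    then have "dim ((\<lambda>f. f w') ` ?K) \<le> dim ((\<lambda>f. f w') ` K)" by (intro dim_subset) auto
    then show ?thesis using insert.prems(3)[of w'] by simp
  qed
  have IH: "ops.fin_spanned ?K" "ops.dim ?K \<le> t * card W + ops.dim {f \<in> K. \<forall>w\<in>insert w W. f w = 0}"
    using insert.IH[OF sub _ dims] insert.prems(2,4) unfolding eq by auto
  have R: "fin_spanned ((\<lambda>f. f w) ` K)"
    using insert.prems(2) by (intro fin_spanned_subset[OF fin_range]) (auto intro: Endo_range)
  have "ops.fin_spanned K \<and> ops.dim K = ops.dim ?K + dim ((\<lambda>f. f w) ` K)"
    using eval.rank_nullity[OF linear_eval insert.prems(1) _ R] IH(1) by simp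
  then show ?case using IH(2) insert.prems(3)[of w] insert.hyps by simp
qed auto

text \<open>Evaluation at a basis of a complement of \<open>M\<close> embeds \<open>K\<close> into as many orbits as the codimension
  of \<open>M\<close>.\<close>

lemma dim_killing:
  assumes K: "ops.subspace K" "K \<subseteq> Endo" and t: "\<And>w. dim ((\<lambda>f. f w) ` K) \<le> t"
    and M: "M \<subseteq> range P" "\<And>f m. f \<in> K \<Longrightarrow> m \<in> M \<Longrightarrow> f m = 0"
  shows "ops.fin_spanned K \<and> ops.dim K \<le> t * (dim (range P) - dim M)"
proof -
  obtain BM where BM: "BM \<subseteq> M" "independent BM" "M \<subseteq> span BM" "card BM = dim M"
    using basis_exists .
  obtain B where B: "BM \<subseteq> B" "B \<subseteq> range P" "independent B" "range P \<subseteq> span B"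
    using maximal_independent_subset_extend[OF subset_trans[OF BM(1) M(1)] BM(2)] .
  have finB: "finite B" using finite_independent[OF fin_range B(3,2)] .
  have cB: "card B = dim (range P)" using basis_card_eq_dim[OF B(2,4,3)] .
  have ann: "{f \<in> K. \<forall>w\<in>B - BM. f w = 0} = {0}"
  proof -
    have "f = 0" if f: "f \<in> K" "\<forall>w\<in>B - BM. f w = 0" for f
    proof (rule ext)
      fix v
      have B0: "f b = 0" if "b \<in> B" for b using f M BM that by auto
      have "f (P v) = 0"
        using module_hom.eq_0_on_span[of scale scale f B "P v"] Endo_linear[of f] B0 B(4) f K
        by (metis Vector_Spaces.linear.axioms(3) range_eqI subsetD)
      then show "f v = 0 v" using Endo_P[of f v] f K by auto
    qed
    moreover have "0 \<in> K" using K ops.subspace_0 by blast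
    ultimately show ?thesis by auto
  qed
  have "ops.fin_spanned {0}" by (simp add: ops.fin_spanned_finite)
  moreover have "ops.dim {0::'v \<Rightarrow> 'v} = 0" using ops.dim_le_card[of "{0}" "{}"] by auto
  ultimately have "ops.fin_spanned K \<and> ops.dim K \<le> t * card (B - BM)"
    using dim_annihilator[of "B - BM" K t] finB K t unfolding ann by auto
  moreover have "card (B - BM) = dim (range P) - dim M"
    using BM B cB finB by (metis card_Diff_subset finite_subset)
  ultimately show ?thesis by simp
qed

end

section \<open>Commutative algebras of operators\<close>

context projection
begin

definition comm_alg :: "('v \<Rightarrow> 'v) set \<Rightarrow> bool" where
  "comm_alg J \<longleftrightarrow> ops.subspace J \<and> J \<subseteq> Endo \<and> P \<in> J \<and>
    (\<forall>f\<in>J. \<forall>g\<in>J. f \<circ> g \<in> J \<and> f \<circ> g = g \<circ> f)"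

definition orbit :: "('v \<Rightarrow> 'v) set \<Rightarrow> 'v \<Rightarrow> 'v set" where
  "orbit J v = (\<lambda>f. f v) ` J"

lemma subspace_orbit: "ops.subspace J \<Longrightarrow> subspace (orbit J v)"
  unfolding orbit_def
  by (rule module_hom.subspace_image[OF Vector_Spaces.linear.axioms(3)[OF linear_eval]])

lemma orbit_range: "J \<subseteq> Endo \<Longrightarrow> orbit J v \<subseteq> range P"
  by (auto simp: orbit_def intro: Endo_range)

lemma fin_spanned_orbit: "J \<subseteq> Endo \<Longrightarrow> fin_spanned (orbit J v)"
  by (rule fin_spanned_subset[OF fin_range orbit_range])

lemma comm_algD:
  assumes "comm_alg J"
  shows "ops.subspace J" "J \<subseteq> Endo" "P \<in> J"
    "f \<in> J \<Longrightarrow> g \<in> J \<Longrightarrow> f \<circ> g \<in> J" "f \<in> J \<Longrightarrow> g \<in> J \<Longrightarrow> f (g w) = g (f w)"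
  using assms unfolding comm_alg_def by (auto simp: fun_eq_iff)

text \<open>Schur's bound on the dimension of a commutative algebra, in a form that keeps room for further
  operators: \<open>M\<close> may be any subspace killed by the annihilator \<open>K\<close> of \<open>v\<close>. The vector \<open>v\<close> is one
  with the largest orbit, of dimension \<open>s\<close>. If some \<open>K w\<close> had dimension \<open>s\<close>, it would be the whole
  orbit of \<open>w\<close>, so some \<open>x \<in> K\<close> would fix \<open>w\<close> and kill \<open>v\<close>; then the orbit of \<open>v + w\<close> would contain
  the orbits of \<open>v\<close> and \<open>w\<close> independently. Hence \<open>K w\<close> has dimension at most \<open>s - 1\<close> for every \<open>w\<close>.\<close>

lemma schur_bound:
  assumes J: "comm_alg J"
  shows "\<exists>v. P v = v \<and> (\<forall>M\<subseteq>range P. (\<forall>f\<in>J. f v = 0 \<longrightarrow> (\<forall>m\<in>M. f m = 0)) \<longrightarrow>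
    ops.dim J \<le> dim (orbit J v) + (dim (orbit J v) - 1) * (dim (range P) - dim M))"
proof -
  note J' = comm_algD[OF J]
  have "dim (orbit J v) < Suc (dim (range P))" for v
    using dim_subset[OF fin_range orbit_range[OF J'(2)]] by (simp add: le_imp_less_Suc)
  then have "\<exists>v. True \<and> (\<forall>w. True \<longrightarrow> dim (orbit J w) \<le> dim (orbit J v))"
    by (intro ex_has_greatest_nat[where b = "Suc (dim (range P))"]) auto
  then obtain v0 where v0: "\<And>w. dim (orbit J w) \<le> dim (orbit J v0)" by blast
  define v where "v = P v0"
  have Pv: "P v = v" by (simp add: v_def P_P)
  have "orbit J v = orbit J v0"
    unfolding orbit_def v_def using J'(2) by (intro image_cong) (auto simp: Endo_P)
  then have max: "dim (orbit J w) \<le> dim (orbit J v)" for w using v0 by simp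
  define s where "s = dim (orbit J v)"
  define K where "K = {f \<in> J. f v = 0}"
  have K: "ops.subspace K" "K \<subseteq> J" using J'(1) by (auto simp: K_def ops.subspace_def)
  then have KE: "K \<subseteq> Endo" using J'(2) by auto
  have Kw: "dim ((\<lambda>f. f w) ` K) \<le> s - 1" for w
  proof (rule ccontr)
    assume a: "\<not> dim ((\<lambda>f. f w) ` K) \<le> s - 1"
    have sub: "(\<lambda>f. f w) ` K \<subseteq> orbit J w" using K by (auto simp: orbit_def)
    have "dim ((\<lambda>f. f w) ` K) \<le> s"
      using dim_subset[OF fin_spanned_orbit[OF J'(2)] sub] max[of w] by (simp add: s_def)
    with a have s: "dim ((\<lambda>f. f w) ` K) = s" "s > 0" by auto
    have eq: "(\<lambda>f. f w) ` K = orbit J w"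
      using subspace_dim_ge_eq[OF fin_spanned_orbit[OF J'(2)] subspace_orbit[OF K(1), of w, unfolded orbit_def] sub]
        s max[of w] by (simp add: s_def)
    have "P w \<in> orbit J w" using J'(3) by (auto simp: orbit_def)
    then obtain x where x: "x \<in> K" "x w = P w" unfolding eq[symmetric] by auto
    have xJ: "x \<in> J" "x v = 0" "x \<in> Endo" using x K J' by (auto simp: K_def)
    let ?u = "v + w"
    have xu: "x ?u = P w" using xJ x by (simp add: Endo_add)
    \<comment> \<open>\<open>x\<close> acts on the orbit of \<open>v + w\<close> with the orbit of \<open>v\<close> in its kernel and the orbit of \<open>w\<close> as its image\<close>
    have ker: "orbit J v \<subseteq> {y \<in> orbit J ?u. x y = 0}"
    proof
      fix y assume "y \<in> orbit J v"
      then obtain j where j: "j \<in> J" "y = j v" by (auto simp: orbit_def)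
      have jE: "j \<in> Endo" using j J' by auto
      have "P - x \<in> J" using ops.subspace_diff[OF J'(1) J'(3) xJ(1)] .
      then have "j \<circ> (P - x) \<in> J" using J'(4) j by blast
      moreover have "(j \<circ> (P - x)) ?u = y"
        using xu by (simp add: P_add Pv j fun_diff_def)
      ultimately have "y \<in> orbit J ?u" unfolding orbit_def by (metis image_eqI)
      moreover have "x y = 0" using J'(5)[of x j v] xJ j jE by (simp add: Endo_zero)
      ultimately show "y \<in> {y \<in> orbit J ?u. x y = 0}" by simp
    qed
    have im: "x ` orbit J ?u = orbit J w"
    proof -
      have "x (j ?u) = j w" if "j \<in> J" for j
        using J'(5)[of x j ?u] xJ that xu Endo_P[of j w] J'(2) by auto
      then show ?thesis unfolding orbit_def image_image by (rule image_cong[OF refl])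
    qed
    have fk: "fin_spanned {y \<in> orbit J ?u. x y = 0}"
      by (rule fin_spanned_subset[OF fin_spanned_orbit[OF J'(2), of ?u]]) auto
    have fi: "fin_spanned (x ` orbit J ?u)"
      unfolding im by (rule fin_spanned_orbit[OF J'(2)])
    have "dim (orbit J ?u) = dim {y \<in> orbit J ?u. x y = 0} + dim (x ` orbit J ?u)"
      using self.rank_nullity[OF Endo_linear[OF xJ(3)] subspace_orbit[OF J'(1)] fk fi] by simp
    moreover have "s \<le> dim {y \<in> orbit J ?u. x y = 0}"
      unfolding s_def by (rule dim_subset[OF fk ker])
    moreover have "s \<le> dim (x ` orbit J ?u)" unfolding im eq[symmetric] using s by simp
    ultimately show False using max[of ?u] s by (simp add: s_def)
  qed
  have bound: "ops.dim J \<le> s + (s - 1) * (dim (range P) - dim M)"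
    if M: "M \<subseteq> range P" "\<forall>f\<in>J. f v = 0 \<longrightarrow> (\<forall>m\<in>M. f m = 0)" for M
  proof -
    have "ops.fin_spanned K \<and> ops.dim K \<le> (s - 1) * (dim (range P) - dim M)"
      using dim_killing[OF K(1) KE Kw M(1)] M(2) by (auto simp: K_def)
    moreover from this have "ops.dim J = ops.dim K + s"
      using eval.rank_nullity[OF linear_eval[of v] J'(1)] fin_spanned_orbit[OF J'(2), of v]
      unfolding K_def s_def orbit_def by simp
    ultimately show ?thesis by simp
  qed
  show ?thesis
    proof (intro exI[of _ v] conjI allI impI)
    fix M assume "M \<subseteq> range P" "\<forall>f\<in>J. f v = 0 \<longrightarrow> (\<forall>m\<in>M. f m = 0)"
    then show "ops.dim J \<le> dim (orbit J v) + (dim (orbit J v) - 1) * (dim (range P) - dim M)"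
      unfolding s_def[symmetric] by (rule bound)
  qed (rule Pv)
qed

text \<open>The combinations of the \<open>h i\<close> that send \<open>v\<close> into its orbit are isotropic for the form
  \<open>\<phi> ([x, y] v)\<close>: if \<open>x v = f v\<close> and \<open>y v = g v\<close>, then \<open>x y v = x g v = g x v = g f v\<close> and likewise
  \<open>y x v = f g v\<close>, which is the same vector.\<close>

lemma symplectic_bound:
  fixes \<phi> :: "'v \<Rightarrow> 'k"
  assumes J: "comm_alg J" and finI: "finite I"
    and h: "\<And>i. i \<in> I \<Longrightarrow> h i \<in> Endo" "\<And>i f w. i \<in> I \<Longrightarrow> f \<in> J \<Longrightarrow> h i (f w) = f (h i w)"
    and \<phi>: "Vector_Spaces.linear scale (*) \<phi>"
    and nondeg: "\<And>x. (\<forall>j\<in>I. (\<Sum>i\<in>I. x i * (\<phi> (h i (h j v)) - \<phi> (h j (h i v)))) = 0) \<Longrightarrow> \<forall>i\<in>I. x i = 0"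
  shows "card I + 2 * dim (orbit J v) \<le> 2 * dim (span (orbit J v \<union> (\<lambda>i. h i v) ` I))"
proof (rule isotropic_bound[OF finI subspace_orbit fin_spanned_orbit nondeg])
  note J' = comm_algD[OF J]
  show "ops.subspace J" "J \<subseteq> Endo" using J' by auto
  interpret \<phi>: Vector_Spaces.linear scale "(*)" \<phi> by fact
  fix x y
  assume "(\<Sum>i\<in>I. x i *s h i v) \<in> orbit J v" "(\<Sum>i\<in>I. y i *s h i v) \<in> orbit J v"
  then obtain f g where f: "f \<in> J" "(\<Sum>i\<in>I. x i *s h i v) = f v"
    and g: "g \<in> J" "(\<Sum>i\<in>I. y i *s h i v) = g v" by (auto simp: orbit_def)
  have 1: "(\<Sum>i\<in>I. \<Sum>j\<in>I. (x' i * y' j) * \<phi> (h i (h j v))) = \<phi> (k (l v))"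
    if "k \<in> J" "l \<in> J" "(\<Sum>i\<in>I. x' i *s h i v) = l v" "(\<Sum>i\<in>I. y' i *s h i v) = k v" for x' y' k l
  proof -
    have kE: "k \<in> Endo" using that J' by auto
    have "(\<Sum>i\<in>I. \<Sum>j\<in>I. (x' i * y' j) * \<phi> (h i (h j v))) = \<phi> (\<Sum>i\<in>I. x' i *s h i (\<Sum>j\<in>I. y' j *s h j v))"
      by (simp only: \<phi>.sum \<phi>.scale, intro sum.cong refl)
        (simp add: Endo_sum[OF h(1)] Endo_scale[OF h(1)] \<phi>.sum \<phi>.scale sum_distrib_left)
    also have "\<dots> = \<phi> (k (\<Sum>i\<in>I. x' i *s h i v))"
      unfolding that(4) by (simp add: h(2)[OF _ that(1)] Endo_sum[OF kE] Endo_scale[OF kE])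
    finally show ?thesis by (simp add: that(3))
  qed
  have swap: "(\<Sum>i\<in>I. \<Sum>j\<in>I. (y i * x j) * \<phi> (h i (h j v))) = (\<Sum>i\<in>I. \<Sum>j\<in>I. x i * y j * \<phi> (h j (h i v)))"
    by (rule trans[OF sum.swap]) (intro sum.cong refl, simp only: mult.commute[of "y _"])
  have "(\<Sum>i\<in>I. \<Sum>j\<in>I. x i * y j * (\<phi> (h i (h j v)) - \<phi> (h j (h i v)))) =
      (\<Sum>i\<in>I. \<Sum>j\<in>I. (x i * y j) * \<phi> (h i (h j v))) - (\<Sum>i\<in>I. \<Sum>j\<in>I. (y i * x j) * \<phi> (h i (h j v)))"
    unfolding swap by (simp only: sum_subtractf right_diff_distrib)
  also have "\<dots> = \<phi> (g (f v)) - \<phi> (f (g v))"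
    using 1[OF g(1) f(1) f(2) g(2)] 1[OF f(1) g(1) g(2) f(2)] by simp
  also have "\<dots> = 0" using J'(5)[OF g(1) f(1)] by simp
  finally show "(\<Sum>i\<in>I. \<Sum>j\<in>I. x i * y j * (\<phi> (h i (h j v)) - \<phi> (h j (h i v)))) = 0" .
qed

inductive_set alg :: "('v \<Rightarrow> 'v) set \<Rightarrow> ('v \<Rightarrow> 'v) set" for G where
  alg_P: "P \<in> alg G"
| alg_comp: "g \<in> G \<Longrightarrow> f \<in> alg G \<Longrightarrow> g \<circ> f \<in> alg G"
| alg_add: "f \<in> alg G \<Longrightarrow> f' \<in> alg G \<Longrightarrow> f + f' \<in> alg G"
| alg_scale: "f \<in> alg G \<Longrightarrow> (\<lambda>x. c *s f x) \<in> alg G"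

lemma alg_commute:
  assumes "h \<in> Endo" "\<And>g w. g \<in> G \<Longrightarrow> h (g w) = g (h w)" "f \<in> alg G"
  shows "h (f w) = f (h w)"
  using assms(3)
proof (induction arbitrary: w)
  case alg_P then show ?case using assms by (simp add: Endo_P P_Endo_apply)
qed (use assms in \<open>auto simp: Endo_add Endo_scale\<close>)

lemma alg_Endo:
  assumes "G \<subseteq> Endo" "f \<in> alg G" shows "f \<in> Endo"
  using assms(2)
proof induction
  case alg_P show ?case by (rule P_Endo)
next
  case (alg_comp g f) then show ?case using assms(1) comp_Endo by blast
next
  case (alg_add f f') then show ?case using ops.subspace_add[OF subspace_Endo] by blast
next
  case (alg_scale f c) then show ?case using ops.subspace_scale[OF subspace_Endo] by blast
qed

lemma alg_generator:
  assumes "G \<subseteq> Endo" "g \<in> G" shows "g \<in> alg G"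
proof -
  have "g \<in> Endo" using assms by auto
  then have "g \<circ> P = g" by (simp add: fun_eq_iff Endo_P)
  then show ?thesis using alg_comp[OF assms(2) alg_P] by simp
qed

lemma comm_alg_alg:
  assumes G: "G \<subseteq> Endo" "\<And>g h w. g \<in> G \<Longrightarrow> h \<in> G \<Longrightarrow> g (h w) = h (g w)"
  shows "comm_alg (alg G)"
  unfolding comm_alg_def
proof (intro conjI ballI)
  have z: "(\<lambda>x. 0 *s P x) \<in> alg G" by (intro alg.intros)
  then have "0 \<in> alg G" by (simp add: zero_fun_def)
  then show "ops.subspace (alg G)" by (auto simp: ops.subspace_def intro: alg.intros)
  show "alg G \<subseteq> Endo" using alg_Endo[OF G(1)] by auto
  show "P \<in> alg G" by (rule alg_P)
  fix f h assume f: "f \<in> alg G" and h: "h \<in> alg G"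
  show "f \<circ> h \<in> alg G" using f
  proof induction
    case alg_P
    have "P \<circ> h = h" using alg_Endo[OF G(1) h] by (auto simp: P_Endo_apply)
    then show ?case using h by simp
  next
    case (alg_comp g f) then show ?case by (metis alg.alg_comp comp_assoc)
  next
    case (alg_add f f')
    have "(f + f') \<circ> h = (f \<circ> h) + (f' \<circ> h)" by (auto simp: fun_eq_iff)
    then show ?case using alg.alg_add[OF alg_add.IH] by (simp only:)
  next
    case (alg_scale f c)
    have "(\<lambda>x. c *s f x) \<circ> h = (\<lambda>x. c *s (f \<circ> h) x)" by auto
    then show ?case using alg_scale by (auto intro: alg.intros)
  qed
  have "g (h w) = h (g w)" if "g \<in> G" for g w
    using alg_commute[of g G h w] G h that by auto
  then have "h (f w) = f (h w)" for w
    using alg_commute[of h G f w] alg_Endo[OF G(1) h] f by auto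
  then show "f \<circ> h = h \<circ> f" by auto
qed

lemma exists_trace:
  "\<exists>tr :: ('v \<Rightarrow> 'v) \<Rightarrow> 'k. (\<forall>f\<in>Endo. \<forall>g\<in>Endo. tr (f \<circ> g) = tr (g \<circ> f) \<and> tr (f + g) = tr f + tr g) \<and>
    (\<forall>c. \<forall>f\<in>Endo. tr (\<lambda>v. c *s f v) = c * tr f) \<and> tr P = of_nat (dim (range P))"
proof -
  obtain B where B: "B \<subseteq> range P" "independent B" "range P \<subseteq> span B" "card B = dim (range P)"
    using basis_exists .
  have finB: "finite B" using finite_independent[OF fin_range B(2,1)] .
  define r where "r v b = representation B v b" for v b
  define tr where "tr f = (\<Sum>b\<in>B. r (f b) b)" for f
  have sp: "f v \<in> span B" if "f \<in> Endo" for f v using Endo_range[OF that] B(3) by auto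
  have radd: "r (x + y) b = r x b + r y b" if "x \<in> span B" "y \<in> span B" for x y b
    using representation_add[OF B(2) that(2,1)] by (simp add: r_def)
  have rscale: "r (c *s x) b = c * r x b" if "x \<in> span B" for c x b
    using representation_scale[OF B(2) that] by (simp add: r_def)
  have rsum: "r (\<Sum>i\<in>I. g i) b = (\<Sum>i\<in>I. r (g i) b)" if "\<And>i. i \<in> I \<Longrightarrow> g i \<in> span B" for I :: "'v set" and g b
    using representation_sum[OF B(2), of I g] that by (simp add: r_def)
  have expand: "(\<Sum>b\<in>B. r x b *s b) = x" if "x \<in> span B" for x
    unfolding r_def using sum_representation_eq[OF B(2) that finB] by simp
  have comp: "tr (f \<circ> g) = (\<Sum>b\<in>B. \<Sum>e\<in>B. r (g b) e * r (f e) b)" if fg: "f \<in> Endo" "g \<in> Endo" for f g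
  proof -
    have "r (f (g b)) b = (\<Sum>e\<in>B. r (g b) e * r (f e) b)" for b
    proof -
      have "r (f (g b)) b = r (f (\<Sum>e\<in>B. r (g b) e *s e)) b" using expand[OF sp[OF fg(2)]] by simp
      also have "f (\<Sum>e\<in>B. r (g b) e *s e) = (\<Sum>e\<in>B. r (g b) e *s f e)"
        using fg by (simp add: Endo_sum Endo_scale)
      also have "r \<dots> b = (\<Sum>e\<in>B. r (g b) e * r (f e) b)"
        using sp[OF fg(1)] by (subst rsum) (auto simp: rscale intro: span_scale)
      finally show ?thesis .
    qed
    then show ?thesis by (simp add: tr_def)
  qed
  show ?thesis
  proof (intro exI[of _ tr] conjI ballI allI)
    fix f g assume fg: "f \<in> Endo" "g \<in> Endo"
    show "tr (f \<circ> g) = tr (g \<circ> f)"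
      unfolding comp[OF fg] comp[OF fg(2,1)] by (subst sum.swap) (simp add: mult.commute)
    show "tr (f + g) = tr f + tr g"
      using fg by (simp add: tr_def radd sp sum.distrib)
  next
    fix c f assume "f \<in> Endo"
    then show "tr (\<lambda>v. c *s f v) = c * tr f" by (simp add: tr_def rscale sp sum_distrib_left)
  next
    have "r (P b) b = 1" if "b \<in> B" for b
      using B that representation_basis[OF B(2) that] by (auto simp: r_def range_P_iff subset_iff)
    then show "tr P = of_nat (dim (range P))" by (simp add: tr_def B(4)[symmetric])
  qed
qed

end

context projection
begin

lemma fin_spanned_Endo:
  assumes "ops.subspace K" "K \<subseteq> Endo" shows "ops.fin_spanned K"
proof -
  have "dim ((\<lambda>f. f w) ` K) \<le> dim (range P)" for w
    using assms(2) by (intro dim_subset[OF fin_range]) (auto intro: Endo_range)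
  from dim_killing[OF assms this, of "{}"] show ?thesis by simp
qed

text \<open>Independence modulo \<open>P\<close> makes the generated algebra larger than \<open>card I\<close> by at least one; Schur's
  bound then takes the symmetric form of a product of two numbers. With \<open>M\<close> the orbit itself their sum
  is the dimension of the space.\<close>

lemma commuting_family_bound:
  assumes I: "finite I" "I \<noteq> {}"
    and g: "\<And>i. i \<in> I \<Longrightarrow> g i \<in> Endo" "\<And>i j w. i \<in> I \<Longrightarrow> j \<in> I \<Longrightarrow> g i (g j w) = g j (g i w)"
    and indep: "\<And>t x. (\<And>v. t *s P v + (\<Sum>i\<in>I. x i *s g i v) = 0) \<Longrightarrow> t = 0 \<and> (\<forall>i\<in>I. x i = 0)"
  shows "\<exists>v. 2 \<le> dim (orbit (alg (g ` I)) v) \<and> (\<exists>i\<in>I. g i v \<noteq> 0) \<and> P v = v \<and>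
    (\<forall>M\<subseteq>range P. (\<forall>f\<in>alg (g ` I). f v = 0 \<longrightarrow> (\<forall>m\<in>M. f m = 0)) \<longrightarrow>
      card I \<le> (dim (orbit (alg (g ` I)) v) - 1) * (dim (range P) - dim M + 1))"
proof -
  let ?J = "alg (g ` I)"
  have gE: "g ` I \<subseteq> Endo" using g by auto
  have J: "comm_alg ?J" using g by (intro comm_alg_alg) auto
  note J' = comm_algD[OF J]
  obtain v where Pv: "P v = v" and v: "\<And>M. M \<subseteq> range P \<Longrightarrow> (\<forall>f\<in>?J. f v = 0 \<longrightarrow> (\<forall>m\<in>M. f m = 0)) \<Longrightarrow>
      ops.dim ?J \<le> dim (orbit ?J v) + (dim (orbit ?J v) - 1) * (dim (range P) - dim M)"
    using schur_bound[OF J] by metis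
  define s where "s = dim (orbit ?J v)"
  have card: "card I + 1 \<le> ops.dim ?J"
  proof -
    let ?I = "insert None (Some ` I)"
    let ?u = "\<lambda>i. case i of None \<Rightarrow> P | Some i \<Rightarrow> g i"
    have "card ?I \<le> ops.dim ?J"
    proof (rule ops.card_family_le_dim)
      show "?u ` ?I \<subseteq> ?J" using J'(3) alg_generator[OF gE] by auto
      show "ops.fin_spanned ?J" using fin_spanned_Endo J' by blast
      fix x :: "'a option \<Rightarrow> 'k" assume x: "(\<Sum>i\<in>?I. (\<lambda>v. x i *s ?u i v)) = 0"
      have "x None *s P v + (\<Sum>i\<in>I. x (Some i) *s g i v) = 0" for v
      proof -
        have "(\<Sum>i\<in>?I. (\<lambda>v. x i *s ?u i v)) v = (\<Sum>i\<in>?I. x i *s ?u i v)" by (rule sum_apply)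
        also have "\<dots> = x None *s P v + (\<Sum>i\<in>I. x (Some i) *s g i v)"
          using I by (simp add: sum.reindex)
        finally show ?thesis using x by simp
      qed
      then have "x None = 0 \<and> (\<forall>i\<in>I. x (Some i) = 0)" by (rule indep)
      then show "\<forall>i\<in>?I. x i = 0" by auto
    qed (use I in auto)
    moreover have "card ?I = card I + 1" using I by (simp add: card_image)
    ultimately show ?thesis by simp
  qed
  have cI: "card I \<ge> 1" using I by (simp add: Suc_leI card_gt_0_iff)
  have s2: "s \<ge> 2"
  proof (rule ccontr)
    assume "\<not> 2 \<le> s"
    then have "s - 1 = 0" "s \<le> 1" by auto
    then have "ops.dim ?J \<le> 1" using v[of "{}"] unfolding s_def by simp
    then show False using card cI by simp
  qed
  have "\<exists>i\<in>I. g i v \<noteq> 0"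
  proof (rule ccontr)
    assume 0: "\<not> (\<exists>i\<in>I. g i v \<noteq> 0)"
    have "f v \<in> span {v}" if "f \<in> ?J" for f
      using that
    proof induction
      case alg_P then show ?case using Pv by (simp add: span_base)
    next
      case (alg_comp h f)
      then obtain c i where "f v = c *s v" "h = g i" "i \<in> I" by (auto simp: span_singleton)
      then have "h (f v) = 0" using 0 Endo_scale[OF g(1)[of i], of c v] by auto
      then show ?case by (simp add: span_zero)
    qed (auto intro: span_add span_scale)
    then have "orbit ?J v \<subseteq> span {v}" by (auto simp: orbit_def)
    then have "dim (orbit ?J v) \<le> card {v}" by (rule dim_le_card) simp
    then show False using s2 by (simp add: s_def)
  qed
  moreover have "card I \<le> (s - 1) * (dim (range P) - dim M + 1)"
    if M: "M \<subseteq> range P" "\<forall>f\<in>?J. f v = 0 \<longrightarrow> (\<forall>m\<in>M. f m = 0)" for M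
  proof -
    have "card I + 1 \<le> s + (s - 1) * (dim (range P) - dim M)"
      using card v[OF M] unfolding s_def by simp
    then show ?thesis using s2 by simp
  qed
  ultimately show ?thesis
    using s2 Pv unfolding s_def by (intro exI[of _ v] conjI) simp_all
qed

end

section \<open>Representations of the block matrix algebra\<close>

text \<open>The operators \<open>\<alpha> i j\<close>, \<open>\<gamma> j l\<close>, \<open>\<zeta> i l\<close> are the images of the matrix units in the blocks \<open>A\<close>, \<open>C\<close>, \<open>B\<close>.
  Faithfulness enters only through the independence of the central operators \<open>\<zeta> i l\<close>.\<close>

locale block_rep = projection scale P
  for scale :: "'k::field_char_0 \<Rightarrow> 'v::ab_group_add \<Rightarrow> 'v" (infixr "*s" 75) and P +
  fixes a b c :: nat and \<alpha> \<gamma> \<zeta> :: "nat \<Rightarrow> nat \<Rightarrow> 'v \<Rightarrow> 'v"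
  assumes pos: "0 < a" "0 < b" "0 < c"
    and alpha_Endo: "i < a \<Longrightarrow> j < b \<Longrightarrow> \<alpha> i j \<in> Endo"
    and gamma_Endo: "j < b \<Longrightarrow> l < c \<Longrightarrow> \<gamma> j l \<in> Endo"
    and zeta_Endo: "i < a \<Longrightarrow> l < c \<Longrightarrow> \<zeta> i l \<in> Endo"
    and alpha_alpha: "i < a \<Longrightarrow> j < b \<Longrightarrow> i' < a \<Longrightarrow> j' < b \<Longrightarrow> \<alpha> i j (\<alpha> i' j' v) = \<alpha> i' j' (\<alpha> i j v)"
    and gamma_gamma: "j < b \<Longrightarrow> l < c \<Longrightarrow> j' < b \<Longrightarrow> l' < c \<Longrightarrow> \<gamma> j l (\<gamma> j' l' v) = \<gamma> j' l' (\<gamma> j l v)"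
    and alpha_gamma: "i < a \<Longrightarrow> j < b \<Longrightarrow> k < b \<Longrightarrow> l < c \<Longrightarrow>
      \<alpha> i j (\<gamma> k l v) - \<gamma> k l (\<alpha> i j v) = (if j = k then \<zeta> i l v else 0)"
    and alpha_zeta: "i < a \<Longrightarrow> j < b \<Longrightarrow> i' < a \<Longrightarrow> l < c \<Longrightarrow> \<alpha> i j (\<zeta> i' l v) = \<zeta> i' l (\<alpha> i j v)"
    and gamma_zeta: "j < b \<Longrightarrow> l < c \<Longrightarrow> i < a \<Longrightarrow> l' < c \<Longrightarrow> \<gamma> j l (\<zeta> i l' v) = \<zeta> i l' (\<gamma> j l v)"
    and zeta_indep: "(\<And>v. (\<Sum>i<a. \<Sum>l<c. x i l *s \<zeta> i l v) = 0) \<Longrightarrow> i < a \<Longrightarrow> l < c \<Longrightarrow> x i l = 0"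
begin

lemma zeta_eq: "i < a \<Longrightarrow> l < c \<Longrightarrow> \<zeta> i l v = \<alpha> i 0 (\<gamma> 0 l v) - \<gamma> 0 l (\<alpha> i 0 v)"
  using alpha_gamma[of i 0 0 l v] pos by simp

lemma zeta_zeta:
  assumes "i < a" "l < c" "i' < a" "l' < c" shows "\<zeta> i l (\<zeta> i' l' v) = \<zeta> i' l' (\<zeta> i l v)"
  using assms pos by (simp add: zeta_eq[of i l] alpha_zeta gamma_zeta Endo_diff[OF zeta_Endo])

text \<open>Transposing the block matrices and reversing the order of the blocks exchanges \<open>a\<close> with \<open>c\<close> and \<open>A\<close> with \<open>C\<close>; the
  sign restores the order of the commutator.\<close>

lemma swap_rep:
  "block_rep scale P c b a (\<lambda>l j. \<gamma> j l) (\<lambda>j i v. - \<alpha> i j v) (\<lambda>l i. \<zeta> i l)"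
proof (unfold_locales, goal_cases)
  case (5 j i)
  then show ?case using ops.subspace_neg[OF subspace_Endo alpha_Endo[of i j]] by (simp add: fun_Compl_def)
next
  case (8 j l j' l' v)
  then show ?case by (simp add: Endo_neg[OF alpha_Endo] alpha_alpha[of l j l' j'])
next
  case (9 l j k i v)
  then show ?case using alpha_gamma[of i k j l v] by (simp add: Endo_neg[OF gamma_Endo])
next
  case (11 j l i l' v)
  then show ?case by (simp add: Endo_neg[OF zeta_Endo] alpha_zeta)
next
  case (12 x i l)
  then show ?case using zeta_indep[of "\<lambda>i l. x l i" l i] by (subst (asm) sum.swap) auto
qed (auto simp: pos gamma_Endo zeta_Endo gamma_gamma gamma_zeta)

text \<open>Every \<open>\<zeta> i l\<close> is a commutator, so it has trace zero, whereas the trace of \<open>P\<close> is the dimension,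
  which is nonzero in characteristic zero. This replaces a reduction to nilpotent representations.\<close>

lemma one_notin_zeta:
  assumes "\<And>v. t *s P v + (\<Sum>i<a. \<Sum>l<c. x i l *s \<zeta> i l v) = 0"
  shows "t = 0"
proof -
  obtain tr :: "('v \<Rightarrow> 'v) \<Rightarrow> 'k" where
    T: "\<forall>f\<in>Endo. \<forall>g\<in>Endo. tr (f \<circ> g) = tr (g \<circ> f) \<and> tr (f + g) = tr f + tr g"
      "\<forall>c. \<forall>f\<in>Endo. tr (\<lambda>v. c *s f v) = c * tr f" "tr P = of_nat (dim (range P))"
    using exists_trace by blast
  have tr: "\<And>f g. f \<in> Endo \<Longrightarrow> g \<in> Endo \<Longrightarrow> tr (f \<circ> g) = tr (g \<circ> f)"
    "\<And>f g. f \<in> Endo \<Longrightarrow> g \<in> Endo \<Longrightarrow> tr (f + g) = tr f + tr g"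
    "\<And>c f. f \<in> Endo \<Longrightarrow> tr (\<lambda>v. c *s f v) = c * tr f"
    "tr P = of_nat (dim (range P))" using T by auto
  note E = subspace_Endo
  have tr0: "tr 0 = 0" using tr(3)[OF P_Endo, of 0] by (simp add: zero_fun_def)
  have trsum: "tr (\<Sum>i\<in>I. f i) = (\<Sum>i\<in>I. tr (f i))" if "\<And>i. i \<in> I \<Longrightarrow> f i \<in> Endo" for I :: "nat set" and f
    using that by (induction I rule: infinite_finite_induct)
      (simp_all add: tr0 tr(2) ops.subspace_sum[OF E])
  have trz: "tr (\<zeta> i l) = 0" if "i < a" "l < c" for i l
  proof -
    note e = alpha_Endo[OF that(1) pos(2)] gamma_Endo[OF pos(2) that(2)]
    have "\<zeta> i l + (\<gamma> 0 l \<circ> \<alpha> i 0) = \<alpha> i 0 \<circ> \<gamma> 0 l"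
      using zeta_eq[OF that] by (auto simp: fun_eq_iff)
    then have "tr (\<alpha> i 0 \<circ> \<gamma> 0 l) = tr (\<zeta> i l) + tr (\<gamma> 0 l \<circ> \<alpha> i 0)"
      using tr(2)[OF zeta_Endo[OF that] comp_Endo[OF e(2,1)]] by simp
    then show ?thesis using tr(1)[OF e] by simp
  qed
  define f where "f i l = (\<lambda>v. x i l *s \<zeta> i l v)" for i l
  have fE: "f i l \<in> Endo" if "i < a" "l < c" for i l
    unfolding f_def using ops.subspace_scale[OF E zeta_Endo[OF that]] .
  have trf: "tr (\<Sum>i<a. \<Sum>l<c. f i l) = 0"
  proof -
    have "tr (\<Sum>i<a. \<Sum>l<c. f i l) = (\<Sum>i<a. tr (\<Sum>l<c. f i l))"
      by (rule trsum) (auto intro!: ops.subspace_sum[OF E] fE)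
    also have "\<dots> = (\<Sum>i<a. \<Sum>l<c. tr (f i l))"
      by (intro sum.cong refl trsum fE) auto
    also have "\<dots> = 0"
      using tr(3)[OF zeta_Endo] trz by (intro sum.neutral) (simp add: f_def)
    finally show ?thesis .
  qed
  have tP: "(\<lambda>v. t *s P v) \<in> Endo" using ops.subspace_scale[OF E P_Endo] .
  have "(\<lambda>v. t *s P v) + (\<Sum>i<a. \<Sum>l<c. f i l) = 0"
    using assms by (auto simp: fun_eq_iff sum_apply f_def)
  then have "0 = tr (\<lambda>v. t *s P v) + tr (\<Sum>i<a. \<Sum>l<c. f i l)"
    using tr(2)[OF tP, of "\<Sum>i<a. \<Sum>l<c. f i l"] tr0 fE by (auto intro!: ops.subspace_sum[OF E])
  then have 0: "t * of_nat (dim (range P)) = 0" using trf tr(3)[OF P_Endo] tr(4) by simp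
  have "dim (range P) \<noteq> 0"
  proof
    assume "dim (range P) = 0"
    obtain B where B: "B \<subseteq> range P" "independent B" "range P \<subseteq> span B" "card B = dim (range P)"
      using basis_exists .
    then have "B = {}" using finite_independent[OF fin_range B(2,1)] \<open>dim (range P) = 0\<close> by simp
    then have z: "w = 0" if "w \<in> range P" for w using B(3) that by auto
    then have "\<zeta> i l v = 0" if "i < a" "l < c" for i l v
      using Endo_range[OF zeta_Endo[OF that]] by auto
    then show False using zeta_indep[of "\<lambda>_ _. 1" 0 0] pos by simp
  qed
  then show ?thesis using 0 by simp
qed

text \<open>The rows \<open>R\<close> and columns \<open>Q\<close> select a block of the matrix \<open>\<phi> (\<zeta> p q v)\<close> with trivial kernel on
  both sides. The form \<open>\<phi> ([x, y] v)\<close> pairs the \<open>\<alpha> p j\<close> with the \<open>\<gamma> j q\<close> through one copy of this block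
  for each \<open>j\<close>, so it is nondegenerate.\<close>

lemma heisenberg_bound:
  assumes J: "comm_alg J"
    and comm: "\<And>i j f w. i < a \<Longrightarrow> j < b \<Longrightarrow> f \<in> J \<Longrightarrow> \<alpha> i j (f w) = f (\<alpha> i j w)"
      "\<And>j l f w. j < b \<Longrightarrow> l < c \<Longrightarrow> f \<in> J \<Longrightarrow> \<gamma> j l (f w) = f (\<gamma> j l w)"
    and R: "R \<subseteq> {..<a}" and Q: "Q \<subseteq> {..<c}"
    and \<phi>: "Vector_Spaces.linear scale (*) \<phi>"
    and left: "\<And>x. (\<forall>q\<in>Q. (\<Sum>p\<in>R. x p * \<phi> (\<zeta> p q v)) = 0) \<Longrightarrow> \<forall>p\<in>R. x p = 0"
    and right: "\<And>y. (\<forall>p\<in>R. (\<Sum>q\<in>Q. y q * \<phi> (\<zeta> p q v)) = 0) \<Longrightarrow> \<forall>q\<in>Q. y q = 0"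
  shows "\<exists>M. subspace M \<and> M \<subseteq> range P \<and> (\<forall>f\<in>J. f v = 0 \<longrightarrow> (\<forall>m\<in>M. f m = 0)) \<and>
    b * (card R + card Q) + 2 * dim (orbit J v) \<le> 2 * dim M"
proof -
  note J' = comm_algD[OF J]
  interpret \<phi>: Vector_Spaces.linear scale "(*)" \<phi> by fact
  define I where "I = (R \<times> {..<b}) <+> ({..<b} \<times> Q)"
  define h where "h i = (case i of Inl (p, j) \<Rightarrow> \<alpha> p j | Inr (j, q) \<Rightarrow> \<gamma> j q)" for i
  have fin: "finite R" "finite Q" using R Q finite_subset by blast+
  have hE: "h i \<in> Endo" if "i \<in> I" for i
    using that R Q by (auto simp: I_def h_def alpha_Endo gamma_Endo subset_iff)
  have hJ: "h i (f w) = f (h i w)" if "i \<in> I" "f \<in> J" for i f w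
    using that R Q by (auto simp: I_def h_def comm subset_iff)
  define M where "M = span (orbit J v \<union> (\<lambda>i. h i v) ` I)"
  have "card I + 2 * dim (orbit J v) \<le> 2 * dim M"
    unfolding M_def
  proof (rule symplectic_bound[OF J _ hE hJ \<phi>])
    show "finite I" using fin by (simp add: I_def)
    fix x assume x: "\<forall>j\<in>I. (\<Sum>i\<in>I. x i * (\<phi> (h i (h j v)) - \<phi> (h j (h i v)))) = 0"
    have ag: "\<phi> (\<alpha> p j (\<gamma> k q v)) - \<phi> (\<gamma> k q (\<alpha> p j v)) = (if j = k then \<phi> (\<zeta> p q v) else 0)"
      if "p \<in> R" "q \<in> Q" "j < b" "k < b" for p q j k
    proof -
      have "\<phi> (\<alpha> p j (\<gamma> k q v)) - \<phi> (\<gamma> k q (\<alpha> p j v)) = \<phi> (if j = k then \<zeta> p q v else 0)"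
        unfolding \<phi>.diff[symmetric] using that R Q by (subst alpha_gamma) auto
      then show ?thesis by simp
    qed
    have ga: "\<phi> (\<gamma> k q (\<alpha> p j v)) - \<phi> (\<alpha> p j (\<gamma> k q v)) = - (if j = k then \<phi> (\<zeta> p q v) else 0)"
      if "p \<in> R" "q \<in> Q" "j < b" "k < b" for p q j k
      using ag[OF that] by (simp add: algebra_simps split: if_splits)
    have aa: "\<phi> (\<alpha> p j (\<alpha> p' j' v)) = \<phi> (\<alpha> p' j' (\<alpha> p j v))" if "p \<in> R" "p' \<in> R" "j < b" "j' < b" for p p' j j'
      using that R by (subst alpha_alpha) auto
    have gg: "\<phi> (\<gamma> j q (\<gamma> j' q' v)) = \<phi> (\<gamma> j' q' (\<gamma> j q v))" if "q \<in> Q" "q' \<in> Q" "j < b" "j' < b" for q q' j j'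
      using that Q by (subst gamma_gamma) auto
    have 1: "\<forall>p\<in>R. x (Inl (p, k)) = 0" if k: "k < b" for k
    proof (rule left, rule ballI)
      fix q assume q: "q \<in> Q"
      have "0 = (\<Sum>i\<in>I. x i * (\<phi> (h i (h (Inr (k, q)) v)) - \<phi> (h (Inr (k, q)) (h i v))))"
        using x k q by (auto simp: I_def)
      also have "\<dots> = (\<Sum>(p, j)\<in>R \<times> {..<b}. x (Inl (p, j)) * (\<phi> (\<alpha> p j (\<gamma> k q v)) - \<phi> (\<gamma> k q (\<alpha> p j v))))
          + (\<Sum>(j, q')\<in>{..<b} \<times> Q. x (Inr (j, q')) * (\<phi> (\<gamma> j q' (\<gamma> k q v)) - \<phi> (\<gamma> k q (\<gamma> j q' v))))"
        using fin unfolding I_def by (subst sum.Plus) (auto simp: h_def case_prod_unfold)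
      also have "(\<Sum>(j, q')\<in>{..<b} \<times> Q. x (Inr (j, q')) * (\<phi> (\<gamma> j q' (\<gamma> k q v)) - \<phi> (\<gamma> k q (\<gamma> j q' v)))) = 0"
        using gg k q by (intro sum.neutral) auto
      also have "(\<Sum>(p, j)\<in>R \<times> {..<b}. x (Inl (p, j)) * (\<phi> (\<alpha> p j (\<gamma> k q v)) - \<phi> (\<gamma> k q (\<alpha> p j v))))
          = (\<Sum>p\<in>R. \<Sum>j<b. if j = k then x (Inl (p, j)) * \<phi> (\<zeta> p q v) else 0)"
        unfolding sum.cartesian_product[symmetric] using k q by (intro sum.cong refl) (simp add: ag)
      also have "\<dots> = (\<Sum>p\<in>R. x (Inl (p, k)) * \<phi> (\<zeta> p q v))" using k by simp
      finally show "(\<Sum>p\<in>R. x (Inl (p, k)) * \<phi> (\<zeta> p q v)) = 0" by simp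
    qed
    have 2: "\<forall>q\<in>Q. x (Inr (k, q)) = 0" if k: "k < b" for k
    proof (rule right, rule ballI)
      fix p assume p: "p \<in> R"
      have "0 = (\<Sum>i\<in>I. x i * (\<phi> (h i (h (Inl (p, k)) v)) - \<phi> (h (Inl (p, k)) (h i v))))"
        using x k p by (auto simp: I_def)
      also have "\<dots> = (\<Sum>(p', j)\<in>R \<times> {..<b}. x (Inl (p', j)) * (\<phi> (\<alpha> p' j (\<alpha> p k v)) - \<phi> (\<alpha> p k (\<alpha> p' j v))))
          + (\<Sum>(j, q)\<in>{..<b} \<times> Q. x (Inr (j, q)) * (\<phi> (\<gamma> j q (\<alpha> p k v)) - \<phi> (\<alpha> p k (\<gamma> j q v))))"
        using fin unfolding I_def by (subst sum.Plus) (auto simp: h_def case_prod_unfold)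
      also have "(\<Sum>(p', j)\<in>R \<times> {..<b}. x (Inl (p', j)) * (\<phi> (\<alpha> p' j (\<alpha> p k v)) - \<phi> (\<alpha> p k (\<alpha> p' j v)))) = 0"
        using aa k p by (intro sum.neutral) auto
      also have "(\<Sum>(j, q)\<in>{..<b} \<times> Q. x (Inr (j, q)) * (\<phi> (\<gamma> j q (\<alpha> p k v)) - \<phi> (\<alpha> p k (\<gamma> j q v))))
          = (\<Sum>j<b. \<Sum>q\<in>Q. - (if j = k then x (Inr (j, q)) * \<phi> (\<zeta> p q v) else 0))"
        unfolding sum.cartesian_product[symmetric] using k p by (intro sum.cong refl) (auto simp: ga)
      also have "\<dots> = (\<Sum>q\<in>Q. - (x (Inr (k, q)) * \<phi> (\<zeta> p q v)))"
        using k by (subst sum.swap) (simp add: sum_negf)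
      finally show "(\<Sum>q\<in>Q. x (Inr (k, q)) * \<phi> (\<zeta> p q v)) = 0" by (simp add: sum_negf)
    qed
    show "\<forall>i\<in>I. x i = 0" using 1 2 by (auto simp: I_def)
  qed
  moreover have "card I = b * (card R + card Q)"
    using fin by (simp add: I_def card_Plus card_cartesian_product algebra_simps)
  moreover have "M \<subseteq> range P"
    unfolding M_def using orbit_range[OF J'(2)] Endo_range[OF hE]
    by (intro span_minimal subspace_range) auto
  moreover have "f m = 0" if f: "f \<in> J" "f v = 0" and m: "m \<in> M" for f m
  proof -
    have fE: "f \<in> Endo" using f J' by auto
    show ?thesis
    proof (rule module_hom.eq_0_on_span[OF Vector_Spaces.linear.axioms(3)[OF Endo_linear[OF fE]]])
    show "m \<in> span (orbit J v \<union> (\<lambda>i. h i v) ` I)" using m by (simp add: M_def)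
    fix u assume "u \<in> orbit J v \<union> (\<lambda>i. h i v) ` I"
    then show "f u = 0"
    proof
      assume "u \<in> orbit J v"
      then obtain g where g: "g \<in> J" "u = g v" by (auto simp: orbit_def)
      then show ?thesis using J'(5)[OF f(1) g(1), of v] f(2) J'(2) Endo_zero[of g] by auto
    next
      assume "u \<in> (\<lambda>i. h i v) ` I"
      then obtain i where i: "i \<in> I" "u = h i v" by auto
      then show ?thesis using hJ[OF i(1) f(1), of v] f(2) Endo_zero[OF hE[OF i(1)]] by simp
    qed
  qed
  qed
  moreover have "subspace M" by (simp add: M_def)
  ultimately show ?thesis by (intro exI[of _ M]) auto
qed

end

section \<open>Families of matrices of rank one\<close>

text \<open>The minors of \<open>M + N\<close> show that, once a nonzero member \<open>M\<close> is fixed, every \<open>N\<close> shares its column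
  or its row. The two alternatives describe subgroups, and a group is not the union of two proper
  subgroups.\<close>

lemma rank_one_family:
  fixes W :: "('i \<Rightarrow> 'j \<Rightarrow> 'k::field) set"
  assumes add: "\<And>N N'. N \<in> W \<Longrightarrow> N' \<in> W \<Longrightarrow> (\<lambda>i j. N i j + N' i j) \<in> W"
    and minors: "\<And>N i i' j j'. N \<in> W \<Longrightarrow> i \<in> I \<Longrightarrow> i' \<in> I \<Longrightarrow> j \<in> J \<Longrightarrow> j' \<in> J \<Longrightarrow>
      N i j * N i' j' = N i j' * N i' j"
  shows "(\<exists>q. \<forall>N\<in>W. \<exists>y. \<forall>i\<in>I. \<forall>j\<in>J. N i j = q i * y j) \<or>
    (\<exists>p. \<forall>N\<in>W. \<exists>x. \<forall>i\<in>I. \<forall>j\<in>J. N i j = x i * p j)"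
proof (cases "\<forall>N\<in>W. \<forall>i\<in>I. \<forall>j\<in>J. N i j = 0")
  case True
  then show ?thesis by (intro disjI1 exI[of _ "\<lambda>_. 0"]) auto
next
  case False
  then obtain M i0 j0 where M: "M \<in> W" "i0 \<in> I" "j0 \<in> J" "M i0 j0 \<noteq> 0" by auto
  define q where "q i = M i j0 / M i0 j0" for i
  define p where "p j = M i0 j / M i0 j0" for j
  have Mij: "M i j = M i0 j0 * q i * p j" if "i \<in> I" "j \<in> J" for i j
    using minors[OF M(1) M(2) that(1) M(3) that(2)] M(4) by (simp add: q_def p_def field_simps)
  have alt: "(\<exists>y. \<forall>i\<in>I. \<forall>j\<in>J. N i j = q i * y j) \<or> (\<exists>x. \<forall>i\<in>I. \<forall>j\<in>J. N i j = x i * p j)"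
    if N: "N \<in> W" for N
  proof -
    define n where "n = N i0 j0"
    define x where "x i = N i j0 - n * q i" for i
    define y where "y j = N i0 j - n * p j" for j
    have eq: "N i j = p j * x i + q i * y j + n * q i * p j" if ij: "i \<in> I" "j \<in> J" for i j
    proof -
      have "(M i0 j0 + N i0 j0) * (M i j + N i j) = (M i0 j + N i0 j) * (M i j0 + N i j0)"
        using minors[OF add[OF M(1) N] M(2) ij(1) M(3) ij(2)] .
      then have "M i0 j0 * N i j + n * M i j = M i0 j * N i j0 + N i0 j * M i j0"
        using minors[OF M(1) M(2) ij(1) M(3) ij(2)] minors[OF N M(2) ij(1) M(3) ij(2)]
        by (simp add: algebra_simps n_def)
      moreover have "M i0 j = M i0 j0 * p j" "M i j0 = M i0 j0 * q i"
        using M(4) by (simp_all add: p_def q_def)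
      ultimately have "M i0 j0 * (N i j + n * q i * p j) = M i0 j0 * (p j * N i j0 + N i0 j * q i)"
        using Mij[OF ij] by (simp add: algebra_simps)
      then have "N i j + n * q i * p j = p j * N i j0 + N i0 j * q i" using M(4) by simp
      then show ?thesis by (simp add: x_def y_def algebra_simps)
    qed
    \<comment> \<open>subtracting the multiple of \<open>M\<close> with the entry \<open>n\<close> leaves \<open>p j * x i + q i * y j\<close>, of rank two unless \<open>x\<close> or \<open>y\<close> vanishes\<close>
    have "x i * y j = 0" if ij: "i \<in> I" "j \<in> J" for i j
    proof -
      have "n * N i j = N i0 j * N i j0"
        using minors[OF N M(2) ij(1) M(3) ij(2)] by (simp add: n_def)
      also have "\<dots> = (y j + n * p j) * (x i + n * q i)" by (simp add: x_def y_def)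
      finally show ?thesis unfolding eq[OF ij] by (simp add: algebra_simps)
    qed
    then have "(\<forall>i\<in>I. x i = 0) \<or> (\<forall>j\<in>J. y j = 0)" by fastforce
    then show ?thesis
    proof
      assume "\<forall>i\<in>I. x i = 0"
      then show ?thesis
        by (intro disjI1 exI[of _ "\<lambda>j. y j + n * p j"]) (auto simp: eq algebra_simps)
    next
      assume "\<forall>j\<in>J. y j = 0"
      then show ?thesis
        by (intro disjI2 exI[of _ "\<lambda>i. x i + n * q i"]) (auto simp: eq algebra_simps)
    qed
  qed
  show ?thesis
  proof (rule ccontr)
    assume neg: "\<not> ?thesis"
    then obtain N where N: "N \<in> W" "\<not> (\<exists>y. \<forall>i\<in>I. \<forall>j\<in>J. N i j = q i * y j)" by blast
    from neg obtain N' where N': "N' \<in> W" "\<not> (\<exists>x. \<forall>i\<in>I. \<forall>j\<in>J. N' i j = x i * p j)" by blast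
    obtain x where x: "\<forall>i\<in>I. \<forall>j\<in>J. N i j = x i * p j" using alt[OF N(1)] N(2) by blast
    obtain y where y: "\<forall>i\<in>I. \<forall>j\<in>J. N' i j = q i * y j" using alt[OF N'(1)] N'(2) by blast
    from alt[OF add[OF N(1) N'(1)]] show False
    proof
      assume "\<exists>z. \<forall>i\<in>I. \<forall>j\<in>J. N i j + N' i j = q i * z j"
      then obtain z where z: "\<forall>i\<in>I. \<forall>j\<in>J. N i j + N' i j = q i * z j" ..
      have "\<forall>i\<in>I. \<forall>j\<in>J. N i j = q i * (z j - y j)"
      proof (intro ballI)
        fix i j assume "i \<in> I" "j \<in> J"
        then have "N i j + q i * y j = q i * z j" using y z by metis
        then show "N i j = q i * (z j - y j)" by (simp add: algebra_simps)
      qed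
      then have "\<exists>y. \<forall>i\<in>I. \<forall>j\<in>J. N i j = q i * y j" by (rule exI[of _ "\<lambda>j. z j - y j"])
      with N(2) show False by (rule notE)
    next
      assume "\<exists>z. \<forall>i\<in>I. \<forall>j\<in>J. N i j + N' i j = z i * p j"
      then obtain z where z: "\<forall>i\<in>I. \<forall>j\<in>J. N i j + N' i j = z i * p j" ..
      have "\<forall>i\<in>I. \<forall>j\<in>J. N' i j = (z i - x i) * p j"
      proof (intro ballI)
        fix i j assume "i \<in> I" "j \<in> J"
        then have "x i * p j + N' i j = z i * p j" using x z by metis
        then show "N' i j = (z i - x i) * p j" by (simp add: algebra_simps)
      qed
      then have "\<exists>x. \<forall>i\<in>I. \<forall>j\<in>J. N' i j = x i * p j" by (rule exI[of _ "\<lambda>i. z i - x i"])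
      with N'(2) show False by (rule notE)
    qed
  qed
qed

lemma am_gm_nat: "4 * (x * y) \<le> (x + y)\<^sup>2" for x y :: nat
proof -
  have "0 \<le> (int x - int y)\<^sup>2" by simp
  then have "int (4 * (x * y)) \<le> int ((x + y)\<^sup>2)" by (simp add: power2_eq_square algebra_simps)
  then show ?thesis by (simp only: of_nat_le_iff)
qed

section \<open>Lower bounds from commutative subalgebras\<close>

context block_rep
begin

abbreviation "zeta_alg \<equiv> alg ((\<lambda>(i, l). \<zeta> i l) ` ({..<a} \<times> {..<c}))"

lemma comm_alg_zeta_alg: "comm_alg zeta_alg"
  by (rule comm_alg_alg) (auto simp: zeta_Endo zeta_zeta)

text \<open>Since \<open>q - 1\<close> is the codimension of the space \<open>M\<close> spanned by the orbit of \<open>v\<close> and by the images of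
  \<open>v\<close> under a Heisenberg algebra of \<open>2 * b\<close> operators, the three contributions to the dimension are the
  orbit, the \<open>b\<close> further dimensions of \<open>M\<close>, and \<open>q - 1\<close>.\<close>

lemma zeta_alg_bound:
  "\<exists>v q. P v = v \<and> 2 \<le> dim (orbit zeta_alg v) \<and> (\<exists>i<a. \<exists>l<c. \<zeta> i l v \<noteq> 0) \<and>
    a * c \<le> (dim (orbit zeta_alg v) - 1) * q \<and> dim (orbit zeta_alg v) + q + b \<le> dim (range P) + 1"
proof -
  let ?Z = "{..<a} \<times> {..<c}" and ?g = "\<lambda>(i, l). \<zeta> i l"
  have ind: "t = 0 \<and> (\<forall>p\<in>?Z. x p = 0)"
    if "\<And>v. t *s P v + (\<Sum>p\<in>?Z. x p *s ?g p v) = 0" for t x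
  proof -
    have eq: "t *s P v + (\<Sum>i<a. \<Sum>l<c. x (i, l) *s \<zeta> i l v) = 0" for v
      using that[of v] by (simp add: sum.cartesian_product case_prod_unfold)
    then have "t = 0" by (rule one_notin_zeta)
    moreover from this eq have "x (i, l) = 0" if "i < a" "l < c" for i l
      using zeta_indep[of "\<lambda>i l. x (i, l)" i l] that by simp
    ultimately show ?thesis by auto
  qed
  have "\<exists>v. 2 \<le> dim (orbit zeta_alg v) \<and> (\<exists>p\<in>?Z. ?g p v \<noteq> 0) \<and> P v = v \<and>
    (\<forall>M\<subseteq>range P. (\<forall>f\<in>zeta_alg. f v = 0 \<longrightarrow> (\<forall>m\<in>M. f m = 0)) \<longrightarrow>
      card ?Z \<le> (dim (orbit zeta_alg v) - 1) * (dim (range P) - dim M + 1))"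
    by (rule commuting_family_bound[OF _ _ _ _ ind]) (use pos in \<open>auto simp: zeta_Endo zeta_zeta\<close>)
  then obtain v where v: "2 \<le> dim (orbit zeta_alg v)" "\<exists>p\<in>?Z. ?g p v \<noteq> 0" "P v = v"
    "\<And>M. M \<subseteq> range P \<Longrightarrow> (\<forall>f\<in>zeta_alg. f v = 0 \<longrightarrow> (\<forall>m\<in>M. f m = 0)) \<Longrightarrow>
      card ?Z \<le> (dim (orbit zeta_alg v) - 1) * (dim (range P) - dim M + 1)" by metis
  from v(2) obtain i l where il: "i < a" "l < c" "\<zeta> i l v \<noteq> 0" by auto
  obtain \<phi> where \<phi>: "Vector_Spaces.linear scale (*) \<phi>" "\<phi> (\<zeta> i l v) \<noteq> 0"
    using exists_functional[OF il(3)] by blast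
  have "\<exists>M. subspace M \<and> M \<subseteq> range P \<and> (\<forall>f\<in>zeta_alg. f v = 0 \<longrightarrow> (\<forall>m\<in>M. f m = 0)) \<and>
    b * (card {i} + card {l}) + 2 * dim (orbit zeta_alg v) \<le> 2 * dim M"
  proof (rule heisenberg_bound[OF comm_alg_zeta_alg _ _ _ _ \<phi>(1)])
    show "\<alpha> i j (f w) = f (\<alpha> i j w)" if "i < a" "j < b" "f \<in> zeta_alg" for i j f w
      by (rule alg_commute[OF alpha_Endo _ that(3)]) (use that in \<open>auto simp: alpha_zeta\<close>)
    show "\<gamma> j l (f w) = f (\<gamma> j l w)" if "j < b" "l < c" "f \<in> zeta_alg" for j l f w
      by (rule alg_commute[OF gamma_Endo _ that(3)]) (use that in \<open>auto simp: gamma_zeta\<close>)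
  qed (use il \<phi> in auto)
  then obtain M where M: "M \<subseteq> range P" "\<forall>f\<in>zeta_alg. f v = 0 \<longrightarrow> (\<forall>m\<in>M. f m = 0)"
    "b * (card {i} + card {l}) + 2 * dim (orbit zeta_alg v) \<le> 2 * dim M" by metis
  then have M3: "b + dim (orbit zeta_alg v) \<le> dim M" by simp
  define q where "q = dim (range P) - dim M + 1"
  have "dim M \<le> dim (range P)" using dim_subset[OF fin_range M(1)] .
  then have 1: "dim (orbit zeta_alg v) + q + b \<le> dim (range P) + 1" using M3 by (simp add: q_def)
  have 2: "a * c \<le> (dim (orbit zeta_alg v) - 1) * q"
    using v(4)[OF M(1,2)] unfolding q_def by (simp add: card_cartesian_product)
  show ?thesis using v(3,1) il 1 2 by blast
qed

lemma square_bound: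
  assumes "a = c" shows "a + b + c \<le> dim (range P)"
proof -
  obtain v q where v: "2 \<le> dim (orbit zeta_alg v)" "a * c \<le> (dim (orbit zeta_alg v) - 1) * q"
    "dim (orbit zeta_alg v) + q + b \<le> dim (range P) + 1" using zeta_alg_bound by blast
  define s where "s = dim (orbit zeta_alg v) - 1"
  have "(2 * a)\<^sup>2 \<le> 4 * (s * q)" using v(2) assms by (simp add: s_def power2_eq_square)
  also have "\<dots> \<le> (s + q)\<^sup>2" by (rule am_gm_nat)
  finally have "2 * a \<le> s + q" by (rule power2_le_imp_le) simp
  then show ?thesis using v assms by (simp add: s_def)
qed

text \<open>For \<open>c = 1\<close> all \<open>\<phi> (\<zeta> i l v)\<close> form a single column, so their rank carries no information. Here the
  abelian ideal \<open>C = 0\<close> is large enough by itself: its dimension \<open>a * (a + 2) = b\<^sup>2 - 1\<close> exceeds what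
  Schur's bound allows in dimension less than \<open>2 * b\<close>.\<close>

lemma abelian_bound:
  assumes "c = 1" "b = a + 1" shows "2 * b \<le> dim (range P)"
proof -
  let ?I = "{..<a} \<times> {..<Suc b}"
  define g where "g p = (if snd p < b then \<alpha> (fst p) (snd p) else \<zeta> (fst p) 0)" for p
  let ?J = "alg (g ` ?I)"
  have gE: "g p \<in> Endo" if "p \<in> ?I" for p
    using that assms by (auto simp: g_def alpha_Endo zeta_Endo)
  have gg: "g p (g p' w) = g p' (g p w)" if "p \<in> ?I" "p' \<in> ?I" for p p' w
    using that pos by (auto simp: g_def alpha_alpha alpha_zeta zeta_zeta)
  have ind: "t = 0 \<and> (\<forall>p\<in>?I. x p = 0)"
    if 0: "\<And>v. t *s P v + (\<Sum>p\<in>?I. x p *s g p v) = 0" for t x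
  proof -
    define A where "A v = (\<Sum>i<a. \<Sum>j<b. x (i, j) *s \<alpha> i j v)" for v
    define Z where "Z v = (\<Sum>i<a. x (i, b) *s \<zeta> i 0 v)" for v
    have eq: "t *s P v + A v + Z v = 0" for v
    proof -
      have "(\<Sum>p\<in>?I. x p *s g p v) = (\<Sum>i<a. \<Sum>j<Suc b. x (i, j) *s g (i, j) v)"
        by (simp add: sum.cartesian_product case_prod_unfold del: sum.lessThan_Suc)
      also have "\<dots> = A v + Z v"
        by (simp add: g_def A_def Z_def sum.distrib)
      finally show ?thesis using 0[of v] by (simp add: add.assoc)
    qed
    \<comment> \<open>commuting a relation with \<open>\<gamma> k 0\<close> isolates its coefficients at the \<open>\<alpha> i k\<close>\<close>
    have A: "x (i, k) = 0" if ik: "i < a" "k < b" for i k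
    proof -
      have "(\<Sum>i<a. x (i, k) *s \<zeta> i 0 v) = 0" for v
      proof -
        note gE0 = gamma_Endo[OF ik(2) pos(3)]
        have "A (\<gamma> k 0 v) - \<gamma> k 0 (A v) = (\<Sum>i<a. \<Sum>j<b. x (i, j) *s (\<alpha> i j (\<gamma> k 0 v) - \<gamma> k 0 (\<alpha> i j v)))"
          unfolding A_def by (simp add: Endo_sum[OF gE0] Endo_scale[OF gE0] sum_subtractf scale_right_diff_distrib)
        also have "\<dots> = (\<Sum>i<a. \<Sum>j<b. if j = k then x (i, j) *s \<zeta> i 0 v else 0)"
          using ik pos by (intro sum.cong refl) (simp add: alpha_gamma)
        also have "\<dots> = (\<Sum>i<a. x (i, k) *s \<zeta> i 0 v)" using ik by simp
        finally have 1: "A (\<gamma> k 0 v) - \<gamma> k 0 (A v) = (\<Sum>i<a. x (i, k) *s \<zeta> i 0 v)" .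
        have "A w = - (t *s P w) - Z w" for w
          using eq[of w] by (simp add: algebra_simps eq_neg_iff_add_eq_0)
        moreover have "Z (\<gamma> k 0 v) = \<gamma> k 0 (Z v)"
          unfolding Z_def using ik pos by (simp add: Endo_sum[OF gE0] Endo_scale[OF gE0] gamma_zeta)
        moreover have "P (\<gamma> k 0 v) = \<gamma> k 0 (P v)" using gE0 by (simp add: P_Endo_apply Endo_P)
        ultimately have "A (\<gamma> k 0 v) - \<gamma> k 0 (A v) = 0"
          by (simp add: Endo_diff[OF gE0] Endo_neg[OF gE0] Endo_scale[OF gE0])
        then show ?thesis using 1 by simp
      qed
      then show ?thesis using zeta_indep[of "\<lambda>i l. x (i, k)" i 0] ik assms by simp
    qed
    then have "A v = 0" for v by (simp add: A_def)
    then have eq': "t *s P v + (\<Sum>i<a. \<Sum>l<c. x (i, b) *s \<zeta> i l v) = 0" for v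
      using eq[of v] assms by (simp add: Z_def)
    then have t: "t = 0" by (rule one_notin_zeta)
    have "x (i, b) = 0" if "i < a" for i
      using zeta_indep[of "\<lambda>i l. x (i, b)" i 0] eq' t that assms by simp
    then show ?thesis using t A by (auto simp: less_Suc_eq)
  qed
  have "\<exists>v. 2 \<le> dim (orbit ?J v) \<and> (\<exists>p\<in>?I. g p v \<noteq> 0) \<and> P v = v \<and>
    (\<forall>M\<subseteq>range P. (\<forall>f\<in>?J. f v = 0 \<longrightarrow> (\<forall>m\<in>M. f m = 0)) \<longrightarrow>
      card ?I \<le> (dim (orbit ?J v) - 1) * (dim (range P) - dim M + 1))"
    by (rule commuting_family_bound[OF _ _ gE gg ind]) (use pos in auto)
  then obtain v where v: "2 \<le> dim (orbit ?J v)"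
    "\<And>M. M \<subseteq> range P \<Longrightarrow> (\<forall>f\<in>?J. f v = 0 \<longrightarrow> (\<forall>m\<in>M. f m = 0)) \<Longrightarrow>
      card ?I \<le> (dim (orbit ?J v) - 1) * (dim (range P) - dim M + 1)" by metis
  have J: "comm_alg ?J" using gE gg by (intro comm_alg_alg) auto
  note J' = comm_algD[OF J]
  define s where "s = dim (orbit ?J v)"
  let ?n = "dim (range P)"
  have sn: "s \<le> ?n" unfolding s_def by (rule dim_subset[OF fin_range orbit_range[OF J'(2)]])
  have "f m = 0" if f: "f \<in> ?J" "f v = 0" and m: "m \<in> orbit ?J v" for f m
  proof -
    obtain h where h: "h \<in> ?J" "m = h v" using m by (auto simp: orbit_def)
    then show ?thesis using J'(5)[OF f(1) h(1), of v] f(2) Endo_zero[of h] J'(2) by auto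
  qed
  then have "card ?I \<le> (s - 1) * (?n - s + 1)"
    using v(2)[OF orbit_range[OF J'(2)]] unfolding s_def by blast
  then have "a * (a + 2) \<le> (s - 1) * (?n - s + 1)"
    using assms by (simp add: card_cartesian_product)
  then have "4 * (a * (a + 2)) \<le> ((s - 1) + (?n - s + 1))\<^sup>2"
    using am_gm_nat[of "s - 1" "?n - s + 1"] by linarith
  also have "(s - 1) + (?n - s + 1) = ?n" using sn v(1) by (simp add: s_def)
  finally have n: "4 * (a * (a + 2)) \<le> ?n\<^sup>2" .
  show ?thesis
  proof (rule ccontr)
    assume "\<not> 2 * b \<le> ?n"
    then have "?n \<le> 2 * a + 1" using assms by simp
    then have "?n\<^sup>2 \<le> (2 * a + 1)\<^sup>2" by (rule power_mono) simp
    then have "4 * (a * (a + 2)) \<le> (2 * a + 1)\<^sup>2" using n by linarith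
    then show False using pos by (simp add: power2_eq_square algebra_simps)
  qed
qed

end

section \<open>Central operators of rank one\<close>

lemma exists_nonroot_pair:
  fixes A B C A' B' C' :: "'k::field_char_0"
  assumes "A \<noteq> 0" "C' \<noteq> 0"
  shows "\<exists>t. A + t * B + t * t * C \<noteq> 0 \<and> A' + t * B' + t * t * C' \<noteq> 0"
proof -
  let ?p = "[:A, B, C:] * [:A', B', C':]"
  have "[:A, B, C:] \<noteq> 0" "[:A', B', C':] \<noteq> 0" using assms by simp_all
  then have "?p \<noteq> 0" by (rule no_zero_divisors)
  then have "finite {t. poly ?p t = 0}" by (rule poly_roots_finite)
  then have "{t. poly ?p t = 0} \<noteq> UNIV" using infinite_UNIV_char_0[where 'a = 'k] by metis
  then obtain t where "poly ?p t \<noteq> 0" by blast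
  then have "poly [:A, B, C:] t \<noteq> 0" "poly [:A', B', C':] t \<noteq> 0" by (auto simp only: poly_mult mult_zero_left mult_zero_right)
  then show ?thesis by (intro exI[of _ t]) (auto simp: algebra_simps)
qed

context block_rep
begin

definition functionals :: "('v \<Rightarrow> 'k) set" where
  "functionals = {\<phi>. Vector_Spaces.linear scale (*) \<phi>}"

lemma functional_eqs:
  assumes "\<phi> \<in> functionals"
  shows "\<phi> (v + w) = \<phi> v + \<phi> w" "\<phi> (t *s v) = t * \<phi> v" "\<phi> (v - w) = \<phi> v - \<phi> w" "\<phi> 0 = 0"
proof -
  interpret \<phi>: Vector_Spaces.linear scale "(*)" \<phi> using assms by (simp add: functionals_def)
  show "\<phi> (v + w) = \<phi> v + \<phi> w" "\<phi> (t *s v) = t * \<phi> v" "\<phi> (v - w) = \<phi> v - \<phi> w" "\<phi> 0 = 0"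
    by (simp_all add: \<phi>.add \<phi>.scale \<phi>.diff)
qed

lemma functionals_add:
  assumes "\<phi> \<in> functionals" "\<psi> \<in> functionals" shows "(\<lambda>v. \<phi> v + \<psi> v) \<in> functionals"
  using assms by (auto simp: functionals_def Vector_Spaces.linear_iff algebra_simps)

lemma functionals_separate:
  assumes "\<And>\<phi>. \<phi> \<in> functionals \<Longrightarrow> \<phi> v = 0" shows "v = 0"
  using exists_functional[of v] assms by (auto simp: functionals_def)

lemma exists_zeta_nonzero: "\<exists>v. \<exists>i<a. \<exists>l<c. \<zeta> i l v \<noteq> 0"
  using zeta_alg_bound by blast

text \<open>With \<open>\<zeta> i l = f l \<otimes> g i\<close> the algebra generated by the \<open>\<zeta> i l\<close> is known: the orbit of any \<open>v\<close> with
  \<open>f v \<noteq> 0\<close> is spanned by \<open>v\<close> and the \<open>g i\<close>, and has dimension exactly \<open>a + 1\<close>. So the product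
  \<open>a * c \<le> a * q\<close> gives \<open>c \<le> q\<close>, where the arithmetic-geometric mean would lose if \<open>a \<noteq> c\<close>.\<close>

lemma factored_bound:
  assumes a: "2 \<le> a"
    and fg: "\<And>v i l. i < a \<Longrightarrow> l < c \<Longrightarrow> \<zeta> i l v = f v l *s g i"
  shows "a + b + c \<le> dim (range P)"
proof -
  have g_indep: "\<forall>i<a. x i = 0" if "(\<Sum>i<a. x i *s g i) = 0" for x
  proof (intro allI impI)
    fix i assume i: "i < a"
    have "(\<Sum>i<a. \<Sum>l<c. (if l = 0 then x i else 0) *s \<zeta> i l v) = 0" for v
    proof -
      have "(\<Sum>i<a. \<Sum>l<c. (if l = 0 then x i else 0) *s \<zeta> i l v) = (\<Sum>i<a. \<Sum>l<c. if l = 0 then x i *s \<zeta> i 0 v else 0)"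
        by (intro sum.cong refl) auto
      also have "\<dots> = (\<Sum>i<a. x i *s (f v 0 *s g i))" using pos fg by simp
      also have "\<dots> = f v 0 *s (\<Sum>i<a. x i *s g i)"
        by (simp add: scale_sum_right mult.commute)
      finally show ?thesis using that by simp
    qed
    then show "x i = 0" using zeta_indep[of "\<lambda>i l. if l = 0 then x i else 0" i 0] i pos by simp
  qed
  obtain v q where v: "P v = v" "2 \<le> dim (orbit zeta_alg v)" "\<exists>i<a. \<exists>l<c. \<zeta> i l v \<noteq> 0"
    "a * c \<le> (dim (orbit zeta_alg v) - 1) * q" "dim (orbit zeta_alg v) + q + b \<le> dim (range P) + 1"
    using zeta_alg_bound by blast
  from v(3) obtain l0 where l0: "l0 < c" "f v l0 \<noteq> 0" using fg by auto
  have fg0: "\<zeta> i l (g k) = 0" if "i < a" "l < c" "k < a" for i l k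
  proof -
    \<comment> \<open>\<open>\<zeta> i' l\<close> and \<open>\<zeta> k l0\<close> commute, but their two products map into the independent lines of \<open>g i'\<close> and \<open>g k\<close>\<close>
    obtain i' where i': "i' < a" "i' \<noteq> k" using a by (cases "k = 0") (auto intro: that[of 1] that[of 0])
    have "\<zeta> i' l (\<zeta> k l0 v) = \<zeta> k l0 (\<zeta> i' l v)"
      using i' that l0 by (simp add: zeta_zeta)
    moreover have "\<zeta> i' l (\<zeta> k l0 v) = f v l0 *s \<zeta> i' l (g k)"
      using fg[OF that(3) l0(1), of v] Endo_scale[OF zeta_Endo[OF i'(1) that(2)]] by simp
    moreover have "\<zeta> i' l (g k) = f (g k) l *s g i'" using fg i' that by simp
    moreover have "\<zeta> k l0 (\<zeta> i' l v) = f (\<zeta> i' l v) l0 *s g k" using fg that l0 by simp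
    ultimately have eq: "(f v l0 * f (g k) l) *s g i' = f (\<zeta> i' l v) l0 *s g k" by simp
    have "f v l0 * f (g k) l = 0"
    proof -
      let ?x = "\<lambda>j. (if j = i' then f v l0 * f (g k) l else 0) - (if j = k then f (\<zeta> i' l v) l0 else 0)"
      have "(\<Sum>j<a. ?x j *s g j) = (\<Sum>j<a. if j = i' then (f v l0 * f (g k) l) *s g j else 0)
          - (\<Sum>j<a. if j = k then f (\<zeta> i' l v) l0 *s g j else 0)"
        unfolding sum_subtractf[symmetric] by (rule sum.cong) (auto simp: scale_left_diff_distrib)
      also have "\<dots> = 0" using eq i' that by simp
      finally have "\<forall>j<a. ?x j = 0" by (rule g_indep)
      then have "?x i' = 0" using i' by blast
      then show ?thesis using i' by simp
    qed
    then have "f (g k) l = 0" using l0 by simp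
    then show ?thesis using fg[OF that(1,2), of "g k"] by simp
  qed
  let ?O = "orbit zeta_alg v"
  note J' = comm_algD[OF comm_alg_zeta_alg]
  have upper: "dim ?O \<le> a + 1"
  proof -
    have "h v \<in> span (insert v (g ` {..<a}))" if "h \<in> zeta_alg" for h
      using that
    proof induction
      case alg_P then show ?case using v(1) by (simp add: span_base)
    next
      case (alg_comp z h)
      then obtain i l where "i < a" "l < c" "z = \<zeta> i l" by auto
      then have "(z \<circ> h) v = f (h v) l *s g i" using fg by simp
      moreover have "g i \<in> span (insert v (g ` {..<a}))" using \<open>i < a\<close> by (intro span_base) simp
      ultimately show ?case using span_scale by simp
    next
      case (alg_add h h') then show ?case by (simp add: span_add)
    next
      case (alg_scale h t) then show ?case by (simp add: span_scale)
    qed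
    then have "?O \<subseteq> span (insert v (g ` {..<a}))" by (auto simp: orbit_def)
    then have "dim ?O \<le> card (insert v (g ` {..<a}))" by (rule dim_le_card) simp
    also have "\<dots> \<le> Suc (card (g ` {..<a}))" by (rule card_insert_le_m1) auto
    also have "\<dots> \<le> a + 1" using card_image_le[of "{..<a}" g] by simp
    finally show ?thesis .
  qed
  have lower: "a + 1 \<le> dim ?O"
  proof -
    let ?I = "insert None (Some ` {..<a})"
    let ?u = "\<lambda>i. case i of None \<Rightarrow> v | Some i \<Rightarrow> g i"
    have "card ?I \<le> dim ?O"
    proof (rule card_family_le_dim[OF _ fin_spanned_orbit[OF J'(2)]])
      have "v \<in> ?O" using v(1) J'(3) unfolding orbit_def by (metis image_eqI)
      moreover have "g i \<in> ?O" if "i < a" for i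
      proof -
        have "\<zeta> i l0 \<in> zeta_alg"
          using that l0 zeta_Endo by (intro alg_generator) auto
        then have "\<zeta> i l0 v \<in> ?O" unfolding orbit_def by blast
        then have "(1 / f v l0) *s \<zeta> i l0 v \<in> ?O"
          by (rule subspace_scale[OF subspace_orbit[OF J'(1)]])
        then show ?thesis using fg[OF that l0(1), of v] l0 by simp
      qed
      ultimately show "?u ` ?I \<subseteq> ?O" by auto
      fix x :: "nat option \<Rightarrow> 'k" assume "(\<Sum>i\<in>?I. x i *s ?u i) = 0"
      then have 0: "x None *s v + (\<Sum>i<a. x (Some i) *s g i) = 0" by (simp add: sum.reindex)
      note zE = zeta_Endo[OF pos(1) l0(1)]
      have "\<zeta> 0 l0 (x None *s v + (\<Sum>i<a. x (Some i) *s g i)) = x None *s \<zeta> 0 l0 v + (\<Sum>i<a. x (Some i) *s \<zeta> 0 l0 (g i))"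
        by (simp add: Endo_add[OF zE] Endo_scale[OF zE] Endo_sum[OF zE])
      also have "\<dots> = x None *s \<zeta> 0 l0 v" using fg0[OF pos(1) l0(1)] by simp
      also have "\<dots> = (x None * f v l0) *s g 0" using fg[OF pos(1) l0(1), of v] by simp
      finally have "(x None * f v l0) *s g 0 = 0" using 0 Endo_zero[OF zE] by simp
      moreover have "g 0 \<noteq> 0"
      proof
        assume "g 0 = 0"
        then have "(\<Sum>i<a. (if i = 0 then 1 else 0) *s g i) = 0" by (intro sum.neutral) auto
        then show False using g_indep[of "\<lambda>i. if i = 0 then 1 else 0"] pos by auto
      qed
      ultimately have "x None = 0" using l0 by simp
      then show "\<forall>i\<in>?I. x i = 0" using 0 g_indep[of "\<lambda>i. x (Some i)"] by auto
    qed simp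
    moreover have "card ?I = a + 1" by (simp add: card_image)
    ultimately show ?thesis by simp
  qed
  have "dim ?O = a + 1" using upper lower by simp
  then have "a * c \<le> a * q" "a + 1 + q + b \<le> dim (range P) + 1" using v(4,5) by simp_all
  then show ?thesis using pos by simp
qed

text \<open>The hypothesis says that for each \<open>v\<close> the matrix with rows \<open>l\<close> and columns \<open>(\<phi>, i)\<close> has rank at most
  one. A common column in all these matrices would be a linear relation among the \<open>\<zeta> 0 l\<close>; so they share
  their row, and this factors \<open>\<zeta>\<close>.\<close>

lemma column_type_bound:
  assumes a: "2 \<le> a" and c: "2 \<le> c"
    and col: "\<And>\<phi> \<psi> v i i' l l'. \<phi> \<in> functionals \<Longrightarrow> \<psi> \<in> functionals \<Longrightarrow> i < a \<Longrightarrow> i' < a \<Longrightarrow> l < c \<Longrightarrow> l' < c \<Longrightarrow>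
      \<phi> (\<zeta> i l v) * \<psi> (\<zeta> i' l' v) = \<phi> (\<zeta> i l' v) * \<psi> (\<zeta> i' l v)"
  shows "a + b + c \<le> dim (range P)"
proof -
  define N where "N v l p = (case p of (\<phi>, i) \<Rightarrow> \<phi> (\<zeta> i l v))" for v l and p :: "('v \<Rightarrow> 'k) \<times> nat"
  let ?K = "functionals \<times> {..<a}"
  let ?W = "{N'. \<exists>v. \<forall>l<c. \<forall>p\<in>?K. N' l p = N v l p}"
  have "(\<exists>q. \<forall>N'\<in>?W. \<exists>y. \<forall>l\<in>{..<c}. \<forall>p\<in>?K. N' l p = q l * y p) \<or>
      (\<exists>p. \<forall>N'\<in>?W. \<exists>x. \<forall>l\<in>{..<c}. \<forall>k\<in>?K. N' l k = x l * p k)"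
  proof (rule rank_one_family)
    fix M M' assume "M \<in> ?W" "M' \<in> ?W"
    then obtain v w where "\<forall>l<c. \<forall>p\<in>?K. M l p = N v l p" "\<forall>l<c. \<forall>p\<in>?K. M' l p = N w l p" by auto
    then have "\<forall>l<c. \<forall>p\<in>?K. M l p + M' l p = N (v + w) l p"
      by (auto simp: N_def Endo_add[OF zeta_Endo] functional_eqs)
    then show "(\<lambda>l p. M l p + M' l p) \<in> ?W" by blast
  next
    fix M l l' p p'
    assume M: "M \<in> ?W" and i: "l \<in> {..<c}" "l' \<in> {..<c}" "p \<in> ?K" "p' \<in> ?K"
    then obtain v where v: "\<forall>l<c. \<forall>p\<in>?K. M l p = N v l p" by auto
    have "N v l p * N v l' p' = N v l p' * N v l' p"
      using i col[of "fst p" "fst p'" "snd p" "snd p'" l l' v]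
      by (auto simp: N_def case_prod_unfold mult.commute)
    then show "M l p * M l' p' = M l p' * M l' p" using v i by auto
  qed
  then show ?thesis
  proof
    assume "\<exists>q. \<forall>N'\<in>?W. \<exists>y. \<forall>l\<in>{..<c}. \<forall>p\<in>?K. N' l p = q l * y p"
    then obtain q where "\<forall>N'\<in>?W. \<exists>y. \<forall>l\<in>{..<c}. \<forall>p\<in>?K. N' l p = q l * y p" by blast
    moreover have "N v \<in> ?W" for v by blast
    ultimately have "\<exists>y. \<forall>l\<in>{..<c}. \<forall>p\<in>?K. N v l p = q l * y p" for v by blast
    then obtain y where y: "\<And>v l p. l < c \<Longrightarrow> p \<in> ?K \<Longrightarrow> N v l p = q l * y v p"
      by (metis lessThan_iff)
    have phi: "\<phi> (\<zeta> i l v) = q l * y v (\<phi>, i)" if "\<phi> \<in> functionals" "i < a" "l < c" for \<phi> i l v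
      using y[of l "(\<phi>, i)" v] that by (simp add: N_def)
    define x where "x i l = (if i = 0 then if l = 0 then q 1 else if l = 1 then - q 0 else 0 else 0)" for i l :: nat
    have "(\<Sum>i<a. \<Sum>l<c. x i l *s \<zeta> i l v) = 0" for v
    proof -
      have "(\<Sum>i<a. \<Sum>l<c. x i l *s \<zeta> i l v) = (\<Sum>i<a. if i = 0 then (\<Sum>l<c. x 0 l *s \<zeta> 0 l v) else 0)"
        by (intro sum.cong refl) (auto simp: x_def)
      also have "\<dots> = (\<Sum>l<c. x 0 l *s \<zeta> 0 l v)" using pos by simp
      also have "\<dots> = (\<Sum>l\<in>{0, 1}. x 0 l *s \<zeta> 0 l v)"
        using c by (intro sum.mono_neutral_right) (auto simp: x_def)
      also have "\<dots> = q 1 *s \<zeta> 0 0 v - q 0 *s \<zeta> 0 1 v" by (simp add: x_def)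
      also have "\<dots> = 0"
        using c pos by (intro functionals_separate) (simp add: functional_eqs phi)
      finally show ?thesis .
    qed
    then have "x 0 0 = 0" "x 0 1 = 0" using zeta_indep[of x] pos c by auto
    then have "q 0 = 0" "q 1 = 0" by (auto simp: x_def)
    then have "\<zeta> 0 0 v = 0" for v using pos by (intro functionals_separate) (simp add: phi)
    moreover have "(\<Sum>i<a. \<Sum>l<c. (if i = 0 \<and> l = 0 then 1 else 0) *s \<zeta> i l v) = 0" for v
      using calculation by (intro sum.neutral ballI) auto
    then show ?thesis using zeta_indep[of "\<lambda>i l. if i = 0 \<and> l = 0 then 1 else 0" 0 0] pos by auto
  next
    assume "\<exists>p. \<forall>N'\<in>?W. \<exists>x. \<forall>l\<in>{..<c}. \<forall>k\<in>?K. N' l k = x l * p k"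
    then obtain p where "\<forall>N'\<in>?W. \<exists>x. \<forall>l\<in>{..<c}. \<forall>k\<in>?K. N' l k = x l * p k" by blast
    moreover have "N v \<in> ?W" for v by blast
    ultimately have "\<exists>x. \<forall>l\<in>{..<c}. \<forall>k\<in>?K. N v l k = x l * p k" for v by blast
    then obtain f where f: "\<And>v l k. l < c \<Longrightarrow> k \<in> ?K \<Longrightarrow> N v l k = f v l * p k"
      by (metis lessThan_iff)
    have phi: "\<phi> (\<zeta> i l v) = f v l * p (\<phi>, i)" if "\<phi> \<in> functionals" "i < a" "l < c" for \<phi> i l v
      using f[of l "(\<phi>, i)" v] that by (simp add: N_def)
    obtain w i1 l1 where w: "i1 < a" "l1 < c" "\<zeta> i1 l1 w \<noteq> 0" using exists_zeta_nonzero by blast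
    have f0: "f w l1 \<noteq> 0"
    proof
      assume "f w l1 = 0"
      then have "\<zeta> i1 l1 w = 0" using w by (intro functionals_separate) (simp add: phi)
      then show False using w by simp
    qed
    define g where "g i = (1 / f w l1) *s \<zeta> i l1 w" for i
    have "\<zeta> i l v = f v l *s g i" if "i < a" "l < c" for v i l
    proof -
      have "\<zeta> i l v - f v l *s g i = 0"
        using that w f0 by (intro functionals_separate) (simp add: functional_eqs phi g_def)
      then show ?thesis by simp
    qed
    then show ?thesis by (rule factored_bound[OF a])
  qed
qed

text \<open>For each \<open>v\<close> the matrices \<open>\<phi> (\<zeta> i l v)\<close>, as \<open>\<phi>\<close> varies, share their row or share their column. Both
  properties are given by the vanishing of forms quadratic in \<open>v\<close>. If the first failed at \<open>v\<close> and the
  second at \<open>w\<close>, both would fail at \<open>v + t w\<close> for all but finitely many \<open>t\<close>. So one of the two holds for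
  all \<open>v\<close>, and they are exchanged by transposition.\<close>

lemma rank_one_bound:
  assumes a: "2 \<le> a" and c: "2 \<le> c"
    and minor: "\<And>\<phi> v i i' l l'. \<phi> \<in> functionals \<Longrightarrow> i < a \<Longrightarrow> i' < a \<Longrightarrow> l < c \<Longrightarrow> l' < c \<Longrightarrow>
      \<phi> (\<zeta> i l v) * \<phi> (\<zeta> i' l' v) = \<phi> (\<zeta> i l' v) * \<phi> (\<zeta> i' l v)"
  shows "a + b + c \<le> dim (range P)"
proof -
  define col where "col v \<phi> \<psi> i i' l l' = \<phi> (\<zeta> i l v) * \<psi> (\<zeta> i' l' v) - \<phi> (\<zeta> i l' v) * \<psi> (\<zeta> i' l v)"
    for v and \<phi> \<psi> :: "'v \<Rightarrow> 'k" and i i' l l'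
  define row where "row v \<phi> \<psi> i i' l l' = \<phi> (\<zeta> i l v) * \<psi> (\<zeta> i' l' v) - \<phi> (\<zeta> i' l v) * \<psi> (\<zeta> i l' v)"
    for v and \<phi> \<psi> :: "'v \<Rightarrow> 'k" and i i' l l'
  define Col where "Col v \<longleftrightarrow> (\<forall>\<phi>\<in>functionals. \<forall>\<psi>\<in>functionals. \<forall>i<a. \<forall>i'<a. \<forall>l<c. \<forall>l'<c. col v \<phi> \<psi> i i' l l' = 0)" for v
  define Row where "Row v \<longleftrightarrow> (\<forall>\<phi>\<in>functionals. \<forall>\<psi>\<in>functionals. \<forall>i<a. \<forall>i'<a. \<forall>l<c. \<forall>l'<c. row v \<phi> \<psi> i i' l l' = 0)" for v
  have either: "Col v \<or> Row v" for v
  proof -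
    let ?W = "(\<lambda>\<phi> i l. \<phi> (\<zeta> i l v)) ` functionals"
    have "(\<exists>q. \<forall>N\<in>?W. \<exists>y. \<forall>i\<in>{..<a}. \<forall>l\<in>{..<c}. N i l = q i * y l) \<or>
        (\<exists>p. \<forall>N\<in>?W. \<exists>x. \<forall>i\<in>{..<a}. \<forall>l\<in>{..<c}. N i l = x i * p l)"
    proof (rule rank_one_family)
      fix N N' assume "N \<in> ?W" "N' \<in> ?W"
      then obtain \<phi> \<psi> where "\<phi> \<in> functionals" "\<psi> \<in> functionals" "N = (\<lambda>i l. \<phi> (\<zeta> i l v))" "N' = (\<lambda>i l. \<psi> (\<zeta> i l v))" by auto
      then show "(\<lambda>i l. N i l + N' i l) \<in> ?W"
        using functionals_add by (intro image_eqI[of _ _ "\<lambda>v. \<phi> v + \<psi> v"]) auto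
    qed (use minor in auto)
    then show ?thesis
    proof
      assume "\<exists>q. \<forall>N\<in>?W. \<exists>y. \<forall>i\<in>{..<a}. \<forall>l\<in>{..<c}. N i l = q i * y l"
      then obtain q where "\<forall>\<phi>\<in>functionals. \<exists>y. \<forall>i\<in>{..<a}. \<forall>l\<in>{..<c}. \<phi> (\<zeta> i l v) = q i * y l"
        by auto
      from bchoice[OF this] obtain y where
        "\<forall>\<phi>\<in>functionals. \<forall>i\<in>{..<a}. \<forall>l\<in>{..<c}. \<phi> (\<zeta> i l v) = q i * y \<phi> l" by blast
      then have "\<phi> (\<zeta> i l v) = q i * y \<phi> l" if "\<phi> \<in> functionals" "i < a" "l < c" for \<phi> i l
        using that by simp
      note this [simp]
      have "Row v" unfolding Row_def row_def by (simp add: mult.left_commute mult.commute)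
      then show ?thesis ..
    next
      assume "\<exists>p. \<forall>N\<in>?W. \<exists>x. \<forall>i\<in>{..<a}. \<forall>l\<in>{..<c}. N i l = x i * p l"
      then obtain p where "\<forall>\<phi>\<in>functionals. \<exists>x. \<forall>i\<in>{..<a}. \<forall>l\<in>{..<c}. \<phi> (\<zeta> i l v) = x i * p l"
        by auto
      from bchoice[OF this] obtain x where
        "\<forall>\<phi>\<in>functionals. \<forall>i\<in>{..<a}. \<forall>l\<in>{..<c}. \<phi> (\<zeta> i l v) = x \<phi> i * p l" by blast
      then have "\<phi> (\<zeta> i l v) = x \<phi> i * p l" if "\<phi> \<in> functionals" "i < a" "l < c" for \<phi> i l
        using that by simp
      note this [simp]
      have "Col v" unfolding Col_def col_def by (simp add: mult.left_commute mult.commute)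
      then show ?thesis ..
    qed
  qed
  have "(\<forall>v. Col v) \<or> (\<forall>v. Row v)"
  proof (rule ccontr)
    assume "\<not> ?thesis"
    then obtain v w where nv: "\<not> Col v" and nw: "\<not> Row w" by blast
    from nv obtain \<phi> \<psi> i i' l l' where
      1: "\<phi> \<in> functionals" "\<psi> \<in> functionals" "i < a" "i' < a" "l < c" "l' < c" "col v \<phi> \<psi> i i' l l' \<noteq> 0"
      unfolding Col_def by blast
    from nw obtain \<phi>' \<psi>' j j' m m' where
      2: "\<phi>' \<in> functionals" "\<psi>' \<in> functionals" "j < a" "j' < a" "m < c" "m' < c" "row w \<phi>' \<psi>' j j' m m' \<noteq> 0"
      unfolding Row_def by blast
    define B where "B = \<phi> (\<zeta> i l v) * \<psi> (\<zeta> i' l' w) + \<phi> (\<zeta> i l w) * \<psi> (\<zeta> i' l' v)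
      - \<phi> (\<zeta> i l' v) * \<psi> (\<zeta> i' l w) - \<phi> (\<zeta> i l' w) * \<psi> (\<zeta> i' l v)"
    define B' where "B' = \<phi>' (\<zeta> j m v) * \<psi>' (\<zeta> j' m' w) + \<phi>' (\<zeta> j m w) * \<psi>' (\<zeta> j' m' v)
      - \<phi>' (\<zeta> j' m v) * \<psi>' (\<zeta> j m' w) - \<phi>' (\<zeta> j' m w) * \<psi>' (\<zeta> j m' v)"
    have lin: "\<chi> (\<zeta> k n (v + t *s w)) = \<chi> (\<zeta> k n v) + t * \<chi> (\<zeta> k n w)"
      if "\<chi> \<in> functionals" "k < a" "n < c" for \<chi> k n t
      using functional_eqs[OF that(1)] Endo_add[OF zeta_Endo[OF that(2,3)]] Endo_scale[OF zeta_Endo[OF that(2,3)]] by simp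
    have p1: "col (v + t *s w) \<phi> \<psi> i i' l l' = col v \<phi> \<psi> i i' l l' + t * B + t * t * col w \<phi> \<psi> i i' l l'" for t
      using 1(1-6) by (simp add: col_def lin B_def algebra_simps)
    have p2: "row (v + t *s w) \<phi>' \<psi>' j j' m m' = row v \<phi>' \<psi>' j j' m m' + t * B' + t * t * row w \<phi>' \<psi>' j j' m m'" for t
      using 2(1-6) by (simp add: row_def lin B'_def algebra_simps)
    obtain t where "col (v + t *s w) \<phi> \<psi> i i' l l' \<noteq> 0" "row (v + t *s w) \<phi>' \<psi>' j j' m m' \<noteq> 0"
      unfolding p1 p2 using exists_nonroot_pair[OF 1(7) 2(7)] by blast
    then have "\<not> Col (v + t *s w)" "\<not> Row (v + t *s w)"
      unfolding Col_def Row_def using 1 2 by blast+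
    then show False using either by blast
  qed
  then show ?thesis
  proof
    assume "\<forall>v. Col v"
    then show ?thesis by (intro column_type_bound[OF a c]) (auto simp: Col_def col_def)
  next
    assume "\<forall>v. Row v"
    then have "c + b + a \<le> dim (range P)"
      by (intro block_rep.column_type_bound[OF swap_rep c a])
        (auto simp: Row_def row_def block_rep.functionals_def[OF swap_rep] functionals_def)
    then show ?thesis by simp
  qed
qed

text \<open>If \<open>b = a + c\<close> and some \<open>\<phi> (\<zeta> i l v)\<close> has a nonzero minor of size two, then a family of \<open>4 * b\<close>
  operators with nondegenerate form forces the dimension to be at least \<open>2 * b = a + b + c\<close>. Otherwise
  all these matrices have rank at most one.\<close>

lemma dim_bound:
  assumes "b = a + c \<or> a = c \<and> b \<le> 2 * a"
  shows "a + b + c \<le> dim (range P)"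
proof (cases "b = a + c")
  case False
  then show ?thesis using assms square_bound by blast
next
  case b: True
  consider "c = 1" | "a = 1" | "2 \<le> a" "2 \<le> c" using pos by linarith
  then show ?thesis
  proof cases
    case 1 then show ?thesis using abelian_bound b by simp
  next
    case 2 then show ?thesis using block_rep.abelian_bound[OF swap_rep] b by simp
  next
    case 3
    show ?thesis
    proof (cases "\<forall>\<phi>\<in>functionals. \<forall>v. \<forall>i<a. \<forall>i'<a. \<forall>l<c. \<forall>l'<c.
        \<phi> (\<zeta> i l v) * \<phi> (\<zeta> i' l' v) = \<phi> (\<zeta> i l' v) * \<phi> (\<zeta> i' l v)")
      case True
      then show ?thesis by (intro rank_one_bound[OF 3]) simp
    next
      case False
      then obtain \<phi> v i i' l l' where \<phi>: "\<phi> \<in> functionals" and il: "i < a" "i' < a" "l < c" "l' < c"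
        and ne: "\<phi> (\<zeta> i l v) * \<phi> (\<zeta> i' l' v) \<noteq> \<phi> (\<zeta> i l' v) * \<phi> (\<zeta> i' l v)" by blast
      have d: "i \<noteq> i'" "l \<noteq> l'" using ne by (auto simp: mult.commute)
      have cramer: "x = 0 \<and> y = 0"
        if "x * p + y * r = 0" "x * q + y * s = 0" "p * s \<noteq> q * r" for x y p q r s :: 'k
      proof -
        have "x * (p * s - q * r) = (x * p + y * r) * s - (x * q + y * s) * r" by (simp add: algebra_simps)
        moreover have "y * (p * s - q * r) = (x * q + y * s) * p - (x * p + y * r) * q" by (simp add: algebra_simps)
        ultimately have "x * (p * s - q * r) = 0" "y * (p * s - q * r) = 0"
          by (simp_all only: that(1,2) mult_zero_left diff_self)
        then show ?thesis using that(3) by simp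
      qed
      have J: "comm_alg (alg {})" by (rule comm_alg_alg) auto
      have "\<exists>M. subspace M \<and> M \<subseteq> range P \<and> (\<forall>f\<in>alg {}. f v = 0 \<longrightarrow> (\<forall>m\<in>M. f m = 0)) \<and>
        b * (card {i, i'} + card {l, l'}) + 2 * dim (orbit (alg {}) v) \<le> 2 * dim M"
      proof (rule heisenberg_bound[OF J])
        show "\<alpha> i j (f w) = f (\<alpha> i j w)" if "i < a" "j < b" "f \<in> alg {}" for i j f w
          by (rule alg_commute[OF alpha_Endo _ that(3)]) (use that in auto)
        show "\<gamma> j l (f w) = f (\<gamma> j l w)" if "j < b" "l < c" "f \<in> alg {}" for j l f w
          by (rule alg_commute[OF gamma_Endo _ that(3)]) (use that in auto)
        show "Vector_Spaces.linear scale (*) \<phi>" using \<phi> by (simp add: functionals_def)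
      next
        fix x assume "\<forall>q\<in>{l, l'}. (\<Sum>p\<in>{i, i'}. x p * \<phi> (\<zeta> p q v)) = 0"
        then show "\<forall>p\<in>{i, i'}. x p = 0"
          using cramer[of "x i" "\<phi> (\<zeta> i l v)" "x i'" "\<phi> (\<zeta> i' l v)" "\<phi> (\<zeta> i l' v)" "\<phi> (\<zeta> i' l' v)"] ne d by auto
      next
        fix y assume "\<forall>p\<in>{i, i'}. (\<Sum>q\<in>{l, l'}. y q * \<phi> (\<zeta> p q v)) = 0"
        then show "\<forall>q\<in>{l, l'}. y q = 0"
          using cramer[of "y l" "\<phi> (\<zeta> i l v)" "y l'" "\<phi> (\<zeta> i l' v)" "\<phi> (\<zeta> i' l v)" "\<phi> (\<zeta> i' l' v)"] ne d
          by (auto simp: mult.commute)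
      qed (use il in auto)
      then obtain M where M: "M \<subseteq> range P" "b * (card {i, i'} + card {l, l'}) \<le> 2 * dim M"
        by (metis add_leD1)
      then have "2 * b \<le> dim M" using d by simp
      then show ?thesis using dim_subset[OF fin_range M(1)] b by simp
    qed
  qed
qed

end

section \<open>Coordinates and the natural representation\<close>

definition elem_mat :: "nat \<Rightarrow> nat \<times> nat \<Rightarrow> 'k::field mat" where
  "elem_mat N p = mat N N (\<lambda>q. if q = p then 1 else 0)"

lemma elem_mat_mult:
  assumes "j < N" "k < N"
  shows "elem_mat N (i, j) * elem_mat N (k, l) = (if j = k then elem_mat N (i, l) else 0\<^sub>m N N :: 'k::field mat)"
proof (rule eq_matI)
  fix r s assume "r < dim_row (if j = k then elem_mat N (i, l) else 0\<^sub>m N N :: 'k mat)"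
    "s < dim_col (if j = k then elem_mat N (i, l) else 0\<^sub>m N N :: 'k mat)"
  then have rs: "r < N" "s < N" by (auto simp: elem_mat_def split: if_splits)
  have "(elem_mat N (i, j) * elem_mat N (k, l)) $$ (r, s) =
      (\<Sum>t = 0..<N. (if (r, t) = (i, j) then 1 else 0) * (if (t, s) = (k, l) then 1 else 0 :: 'k))"
    using rs by (simp add: elem_mat_def scalar_prod_def)
  also have "\<dots> = (\<Sum>t = 0..<N. if t = j then (if r = i \<and> j = k \<and> s = l then 1 else 0) else 0)"
    by (rule sum.cong) auto
  also have "\<dots> = (if r = i \<and> j = k \<and> s = l then 1 else 0)" using assms by simp
  finally show "(elem_mat N (i, j) * elem_mat N (k, l)) $$ (r, s) =
      (if j = k then elem_mat N (i, l) else 0\<^sub>m N N :: 'k mat) $$ (r, s)"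
    using rs by (simp add: elem_mat_def)
qed (auto simp: elem_mat_def)

lemma elem_mat_in_n_lie: "n_support a b c (fst p) (snd p) \<Longrightarrow> elem_mat (a + b + c) p \<in> carrier (n_lie a b c)"
  by (auto simp: n_lie_carrier_iff elem_mat_def)

text \<open>In coordinates the representation space becomes the space of sequences supported below \<open>d\<close>, and
  the matrix units act by operators that satisfy the relations of \<open>block_rep\<close>.\<close>

lemma faithful_dim_ge:
  fixes V :: "('k::field_char_0, 'v, 'n) module_scheme"
  assumes rep: "faithful_lie_representation (n_lie a b c :: ('k, 'k mat) lie_struct) V \<pi>"
    and pos: "0 < a" "0 < b" "0 < c" and cond: "b = a + c \<or> a = c \<and> b \<le> 2 * a"
  shows "a + b + c \<le> vectorspace.dim class_ring V"
proof -
  let ?L = "n_lie a b c :: ('k, 'k mat) lie_struct"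
  let ?N = "a + b + c"
  interpret R: faithful_lie_representation ?L V \<pi> by fact
  define d where "d = R.V.dim"
  obtain S where S: "linear_map class_ring (module_vec TYPE('k) d) V S"
      and bij: "bij_betw S (carrier_vec d) (carrier V)"
    using exists_coordinates[OF R.V.vectorspace_axioms R.finite_dimensional] by (auto simp: d_def)
  interpret S: linear_map class_ring "module_vec TYPE('k) d" V S by fact
  define T where "T = inv_into (carrier_vec d) S"
  have Tc: "T v \<in> carrier_vec d" if "v \<in> carrier V" for v
    using bij that unfolding T_def by (metis bij_betw_def inv_into_into)
  have ST: "S (T v) = v" if "v \<in> carrier V" for v
    using bij that unfolding T_def by (metis bij_betw_def f_inv_into_f)
  have Sc: "S w \<in> carrier V" if "w \<in> carrier_vec d" for w
    using bij that by (auto simp: bij_betw_def)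
  have TS: "T (S w) = w" if "w \<in> carrier_vec d" for w
    using bij that unfolding T_def by (simp add: bij_betw_def)
  have S_add: "S (v + w) = S v \<oplus>\<^bsub>V\<^esub> S w" if "v \<in> carrier_vec d" "w \<in> carrier_vec d" for v w
    using S.f_add[of v w] that by (simp add: module_vec_simps)
  have S_smult: "S (k \<cdot>\<^sub>v w) = k \<odot>\<^bsub>V\<^esub> S w" if "w \<in> carrier_vec d" for k w
    using S.f_smult[of k w] that by (simp add: module_vec_simps)
  have T_add: "T (v \<oplus>\<^bsub>V\<^esub> w) = T v + T w" if "v \<in> carrier V" "w \<in> carrier V" for v w
    using TS[of "T v + T w"] S_add[of "T v" "T w"] ST Tc that by simp
  have T_smult: "T (k \<odot>\<^bsub>V\<^esub> v) = k \<cdot>\<^sub>v T v" if "v \<in> carrier V" for k v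
    using TS[of "k \<cdot>\<^sub>v T v"] S_smult[of "T v"] ST Tc that by simp
  have \<pi>c: "\<pi> x v \<in> carrier V" if "x \<in> carrier ?L" "v \<in> carrier V" for x v
    using mod_hom.f_im[OF linear_map.axioms(3)[OF R.linear[OF that(1)]] that(2)] .
  have \<pi>_add: "\<pi> x (v \<oplus>\<^bsub>V\<^esub> w) = \<pi> x v \<oplus>\<^bsub>V\<^esub> \<pi> x w"
    if "x \<in> carrier ?L" "v \<in> carrier V" "w \<in> carrier V" for x v w
    using LinearCombinations.module_hom_add[OF mod_hom.f_hom[OF linear_map.axioms(3)[OF R.linear[OF that(1)]]] that(2,3)] .
  have \<pi>_smult: "\<pi> x (k \<odot>\<^bsub>V\<^esub> v) = k \<odot>\<^bsub>V\<^esub> \<pi> x v"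
    if "x \<in> carrier ?L" "v \<in> carrier V" for x v k
    using LinearCombinations.module_hom_smult[OF mod_hom.f_hom[OF linear_map.axioms(3)[OF R.linear[OF that(1)]]] _ that(2), of k] by simp
  have minus_V: "v \<ominus>\<^bsub>V\<^esub> w = v \<oplus>\<^bsub>V\<^esub> (- 1) \<odot>\<^bsub>V\<^esub> w" if "w \<in> carrier V" for v w
    using R.V.smult_minus_1[OF that] by (simp add: a_minus_def class_ring_simps)
  define sc :: "'k \<Rightarrow> (nat \<Rightarrow> 'k) \<Rightarrow> nat \<Rightarrow> 'k" where "sc k f = (\<lambda>i. k * f i)" for k f
  define sv where "sv f = S (vec d f)" for f
  define em where "em v = (\<lambda>i. if i < d then T v $ i else 0)" for v
  define P :: "(nat \<Rightarrow> 'k) \<Rightarrow> nat \<Rightarrow> 'k" where "P f = (\<lambda>i. if i < d then f i else 0)" for f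
  have svc: "sv f \<in> carrier V" for f unfolding sv_def by (rule Sc) simp
  have sv_em: "sv (em v) = v" if "v \<in> carrier V" for v
  proof -
    have "vec d (em v) = T v" using Tc[OF that] by (intro eq_vecI) (auto simp: em_def)
    then show ?thesis using ST[OF that] by (simp add: sv_def)
  qed
  have sv_add: "sv (f + g) = sv f \<oplus>\<^bsub>V\<^esub> sv g" for f g
  proof -
    have "vec d (f + g) = vec d f + vec d g" by (intro eq_vecI) auto
    then show ?thesis by (simp add: sv_def S_add)
  qed
  have sv_sc: "sv (sc k f) = k \<odot>\<^bsub>V\<^esub> sv f" for k f
  proof -
    have "vec d (sc k f) = k \<cdot>\<^sub>v vec d f" by (intro eq_vecI) (auto simp: sc_def)
    then show ?thesis by (simp add: sv_def S_smult)
  qed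
  have sv_P: "sv (P f) = sv f" for f
  proof -
    have "vec d (P f) = vec d f" by (intro eq_vecI) (auto simp: P_def)
    then show ?thesis by (simp add: sv_def)
  qed
  have em_add: "em (v \<oplus>\<^bsub>V\<^esub> w) = em v + em w" if "v \<in> carrier V" "w \<in> carrier V" for v w
    using Tc[OF that(1)] Tc[OF that(2)] by (auto simp: em_def T_add[OF that] fun_eq_iff)
  have em_smult: "em (k \<odot>\<^bsub>V\<^esub> v) = sc k (em v)" if "v \<in> carrier V" for v k
    using Tc[OF that] by (auto simp: em_def T_smult[OF that] sc_def fun_eq_iff)
  have em_minus: "em (v \<ominus>\<^bsub>V\<^esub> w) = em v - em w" if "v \<in> carrier V" "w \<in> carrier V" for v w
    using that R.V.smult_closed[of "- 1" w] by (auto simp: minus_V em_add em_smult sc_def fun_eq_iff)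
  define op where "op x f = em (\<pi> x (sv f))" for x f
  have op_P: "op x (P f) = op x f" for x f by (simp add: op_def sv_P)
  have P_em: "P (em v) = em v" for v by (auto simp: P_def em_def)
  have op_add_mat: "op (x + y) f = op x f + op y f" if "x \<in> carrier ?L" "y \<in> carrier ?L" for x y f
    using R.rep_add[OF that svc] by (simp add: op_def em_add \<pi>c that svc)
  have op_smult_mat: "op (k \<cdot>\<^sub>m x) f = sc k (op x f)" if "x \<in> carrier ?L" for k x f
    using R.rep_smult[OF that svc] by (simp add: op_def em_smult \<pi>c that svc)
  have op_bracket: "op (x * y - y * x) f = op x (op y f) - op y (op x f)"
    if "x \<in> carrier ?L" "y \<in> carrier ?L" for x y f
    using R.rep_bracket[OF that svc] by (simp add: op_def em_minus sv_em \<pi>c that svc)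
  have zero_in: "0\<^sub>m ?N ?N \<in> carrier ?L" by (simp add: n_lie_carrier_iff)
  have op_zero: "op (0\<^sub>m ?N ?N) f = 0" for f
    using op_smult_mat[OF zero_in, of 0 f] by (simp add: sc_def zero_fun_def)
  interpret lin_space sc
    by unfold_locales (auto simp: sc_def fun_eq_iff algebra_simps)
  have range_span: "range P \<subseteq> span ((\<lambda>j i. if i = j then 1 else 0) ` {..<d})"
  proof
    fix f assume "f \<in> range P"
    then obtain g where f: "f = P g" by auto
    have sum_app: "(\<Sum>j\<in>A. h j) i = (\<Sum>j\<in>A. h j i)" for A and h :: "nat \<Rightarrow> nat \<Rightarrow> 'k" and i
      by (induction A rule: infinite_finite_induct) auto
    have "f = (\<Sum>j<d. sc (g j) (\<lambda>i. if i = j then 1 else 0))"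
    proof
      fix i
      have "(\<Sum>j<d. sc (g j) (\<lambda>i. if i = j then 1 else 0)) i = (\<Sum>j<d. if j = i then g j else 0)"
        unfolding sum_app by (intro sum.cong) (auto simp: sc_def)
      then show "f i = (\<Sum>j<d. sc (g j) (\<lambda>i. if i = j then 1 else 0)) i"
        by (simp add: f P_def)
    qed
    then show "f \<in> span ((\<lambda>j i. if i = j then 1 else 0) ` {..<d})"
      by (auto intro!: span_sum span_scale intro: span_base)
  qed
  interpret projection sc P
  proof (intro projection.intro projection_axioms.intro lin_space_axioms)
    show "Vector_Spaces.linear sc sc P"
      by (auto simp: Vector_Spaces.linear_iff vector_space_axioms) (auto simp: P_def sc_def fun_eq_iff)
    show "P (P f) = P f" for f by (auto simp: P_def)
    from range_span show "fin_spanned (range P)" unfolding fin_spanned_def by blast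
  qed
  have op_Endo: "op x \<in> Endo" if "x \<in> carrier ?L" for x
  proof (rule Endo_I)
    fix f g k
    show "op x (f + g) = op x f + op x g"
      by (simp add: op_def sv_add \<pi>_add em_add \<pi>c svc that)
    show "op x (sc k f) = sc k (op x f)"
      by (simp add: op_def sv_sc \<pi>_smult em_smult \<pi>c svc that)
    show "P (op x f) = op x f" by (simp add: op_def P_em)
    show "op x (P f) = op x f" by (rule op_P)
  qed
  define e :: "nat \<times> nat \<Rightarrow> 'k mat" where "e = elem_mat ?N"
  have eL: "e (i, j) \<in> carrier ?L" if "n_support a b c i j" for i j
    using elem_mat_in_n_lie[of a b c "(i, j)"] that by (simp add: e_def)
  have e_bracket: "op (e (i, j)) (op (e (k, l)) f) - op (e (k, l)) (op (e (i, j)) f) =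
      (if j = k then op (e (i, l)) f else 0)"
    if "n_support a b c i j" "n_support a b c k l" "l \<noteq> i" for i j k l f
  proof -
    have lt: "i < ?N" "j < ?N" "k < ?N" "l < ?N" using that by (auto simp: n_support_def)
    have "e (i, j) * e (k, l) - e (k, l) * e (i, j) = (if j = k then e (i, l) else 0\<^sub>m ?N ?N)"
      using lt that(3) by (auto simp: e_def elem_mat_mult intro!: eq_matI)
        (auto simp: elem_mat_def)
    then show ?thesis
      using op_bracket[OF eL[OF that(1)] eL[OF that(2)], of f] by (auto simp: op_zero)
  qed
  have e_comm: "op (e (i, j)) (op (e (k, l)) f) = op (e (k, l)) (op (e (i, j)) f)"
    if "n_support a b c i j" "n_support a b c k l" "l \<noteq> i" "j \<noteq> k" for i j k l f
    using e_bracket[OF that(1-3), of f] that(4) by simp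
  have op_sum: "op (mat ?N ?N (\<lambda>p. if p \<in> I then x p else 0)) f = (\<Sum>p\<in>I. sc (x p) (op (e p) f))"
    if "finite I" "\<And>i j. (i, j) \<in> I \<Longrightarrow> n_support a b c i j" for I x f
    using that
  proof (induction I rule: finite_induct)
    case empty
    have "mat ?N ?N (\<lambda>p. 0) = (0\<^sub>m ?N ?N :: 'k mat)" by auto
    then show ?case by (simp add: op_zero)
  next
    case (insert p I)
    let ?M = "mat ?N ?N (\<lambda>p. if p \<in> I then x p else 0)"
    have M: "?M \<in> carrier ?L" using insert.prems by (auto simp: n_lie_carrier_iff)
    obtain i j where p: "p = (i, j)" by (cases p)
    have ep: "e p \<in> carrier ?L" using insert.prems eL p by auto
    then have xe: "x p \<cdot>\<^sub>m e p \<in> carrier ?L" by (auto simp: n_lie_carrier_iff)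
    have "mat ?N ?N (\<lambda>q. if q \<in> insert p I then x q else 0) = x p \<cdot>\<^sub>m e p + ?M"
      using insert.hyps by (intro eq_matI) (auto simp: e_def elem_mat_def)
    then show ?case
      using insert by (simp add: op_add_mat[OF xe M] op_smult_mat[OF ep])
  qed
  interpret block_rep sc P a b c "\<lambda>i j. op (e (i, a + j))" "\<lambda>j l. op (e (a + j, a + b + l))"
    "\<lambda>i l. op (e (i, a + b + l))"
  proof unfold_locales
    fix x i l assume x: "\<And>f. (\<Sum>i<a. \<Sum>l<c. sc (x i l) (op (e (i, a + b + l)) f)) = 0"
      and il: "i < a" "l < c"
    define I where "I = (\<lambda>(i, l). (i, a + b + l)) ` ({..<a} \<times> {..<c})"
    define M where "M = mat ?N ?N (\<lambda>p. if p \<in> I then x (fst p) (snd p - (a + b)) else 0)"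
    have Isup: "n_support a b c i j" if "(i, j) \<in> I" for i j using that by (auto simp: I_def n_support_def)
    have M_in: "M \<in> carrier ?L" using Isup by (auto simp: M_def n_lie_carrier_iff)
    have inj: "inj_on (\<lambda>(i, l). (i, a + b + l)) ({..<a} \<times> {..<c})" by (auto simp: inj_on_def)
    have opM: "op M f = 0" for f
    proof -
      have "op M f = (\<Sum>p\<in>I. sc (x (fst p) (snd p - (a + b))) (op (e p) f))"
        unfolding M_def by (rule op_sum) (auto simp: I_def n_support_def)
      also have "\<dots> = (\<Sum>(i, l)\<in>{..<a} \<times> {..<c}. sc (x i l) (op (e (i, a + b + l)) f))"
        unfolding I_def by (subst sum.reindex[OF inj]) (auto intro!: sum.cong)
      finally show ?thesis using x[of f] by (simp add: sum.cartesian_product)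
    qed
    \<comment> \<open>a relation among the \<open>\<zeta> i l\<close> is a matrix in the upper right block that acts as zero\<close>
    have "M = 0\<^sub>m ?N ?N"
    proof (rule R.faithful[OF M_in zero_in])
      fix v assume v: "v \<in> carrier V"
      have "em (\<pi> M v) = em (\<pi> (0\<^sub>m ?N ?N) v)"
        using opM[of "em v"] op_zero[of "em v"] by (simp add: op_def sv_em v)
      then have "sv (em (\<pi> M v)) = sv (em (\<pi> (0\<^sub>m ?N ?N) v))" by simp
      then show "\<pi> M v = \<pi> (0\<^sub>m ?N ?N) v" by (simp add: sv_em \<pi>c M_in zero_in v)
    qed
    then have "M $$ (i, a + b + l) = 0" using il by simp
    moreover have "(i, a + b + l) \<in> I" using il by (auto simp: I_def image_iff)
    ultimately show "x i l = 0" using il by (simp add: M_def)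
  next
    fix i j k l f assume "i < a" "j < b" "k < b" "l < c"
    then show "op (e (i, a + j)) (op (e (a + k, a + b + l)) f) - op (e (a + k, a + b + l)) (op (e (i, a + j)) f)
      = (if j = k then op (e (i, a + b + l)) f else 0)"
      by (subst e_bracket) (auto simp: n_support_def)
  qed (use pos in \<open>auto intro!: op_Endo eL e_comm simp: n_support_def\<close>)
  have "a + b + c \<le> dim (range P)" by (rule dim_bound) (rule cond)
  also have "\<dots> \<le> card ((\<lambda>j i. if i = j then 1 else 0 :: 'k) ` {..<d})" by (rule dim_le_card[OF range_span]) simp
  also have "\<dots> \<le> d" using card_image_le[of "{..<d}"] by simp
  finally show ?thesis by (simp add: d_def)
qed

lemma natural_representation:
  "faithful_lie_representation (n_lie a b c :: ('k::field, 'k mat) lie_struct)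
    (module_vec TYPE('k) (a + b + c)) (\<lambda>X v. X *\<^sub>v v)"
proof -
  let ?L = "n_lie a b c :: ('k, 'k mat) lie_struct"
  let ?N = "a + b + c"
  interpret W: vec_space "TYPE('k)" ?N .
  note car = n_lie_carrierD
  have minus_W: "v \<ominus>\<^bsub>module_vec TYPE('k) ?N\<^esub> w = v - w" if "v \<in> carrier_vec ?N" "w \<in> carrier_vec ?N" for v w
    using W.smult_minus_1[of w] that by (auto simp: a_minus_def class_ring_simps module_vec_simps)
  show ?thesis
  proof (intro faithful_lie_representation.intro lie_representation.intro
      lie_representation_axioms.intro faithful_lie_representation_axioms.intro)
    show "lie_algebra ?L" by (rule n_lie_algebra)
    show "vectorspace class_ring (module_vec TYPE('k) ?N)" by (rule W.vectorspace_axioms)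
    show "W.fin_dim" by simp
  next
    fix X assume X: "X \<in> carrier ?L"
    have "(\<lambda>v. X *\<^sub>v v) \<in> LinearCombinations.module_hom class_ring (module_vec TYPE('k) ?N) (module_vec TYPE('k) ?N)"
      unfolding LinearCombinations.module_hom_def using car[OF X]
      by (auto simp: module_vec_simps mult_add_distrib_mat_vec mult_mat_vec)
    then show "linear_map class_ring (module_vec TYPE('k) ?N) (module_vec TYPE('k) ?N) (\<lambda>v. X *\<^sub>v v)"
      by unfold_locales
  next
    fix X Y v assume *: "X \<in> carrier ?L" "Y \<in> carrier ?L" "v \<in> carrier (module_vec TYPE('k) ?N)"
    note c = car[OF *(1)] car[OF *(2)]
    have v: "v \<in> carrier_vec ?N" using * by (simp add: module_vec_simps)
    show "(X \<oplus>\<^bsub>?L\<^esub> Y) *\<^sub>v v = X *\<^sub>v v \<oplus>\<^bsub>module_vec TYPE('k) ?N\<^esub> Y *\<^sub>v v"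
      using c v by (simp add: module_vec_simps add_mult_distrib_mat_vec)
    show "lie_bracket ?L X Y *\<^sub>v v =
        X *\<^sub>v (Y *\<^sub>v v) \<ominus>\<^bsub>module_vec TYPE('k) ?N\<^esub> Y *\<^sub>v (X *\<^sub>v v)"
      using c v by (simp add: minus_W minus_mult_distrib_mat_vec[of _ ?N ?N] assoc_mult_mat_vec[of _ ?N ?N _ ?N])
  next
    fix X v and k :: 'k assume "X \<in> carrier ?L" "v \<in> carrier (module_vec TYPE('k) ?N)"
    then show "(k \<odot>\<^bsub>?L\<^esub> X) *\<^sub>v v = k \<odot>\<^bsub>module_vec TYPE('k) ?N\<^esub> (X *\<^sub>v v)"
      by (auto simp: module_vec_simps scalar_prod_def sum_distrib_left mult.assoc dest: car intro!: eq_vecI sum.cong)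
  next
    fix X Y assume XY: "X \<in> carrier ?L" "Y \<in> carrier ?L"
      and eq: "\<And>v. v \<in> carrier (module_vec TYPE('k) ?N) \<Longrightarrow> X *\<^sub>v v = Y *\<^sub>v v"
    note c = car[OF XY(1)] car[OF XY(2)]
    show "X = Y"
    proof (rule eq_matI)
      fix i j assume "i < dim_row Y" "j < dim_col Y"
      then have ij: "i < ?N" "j < ?N" using c by auto
      have "X *\<^sub>v unit_vec ?N j = Y *\<^sub>v unit_vec ?N j" by (rule eq) (simp add: module_vec_simps)
      then have "(X *\<^sub>v unit_vec ?N j) $ i = (Y *\<^sub>v unit_vec ?N j) $ i" by simp
      then show "X $$ (i, j) = Y $$ (i, j)" using ij c by simp
    qed (use c in auto)
  qed
qed

theorem mainTheorem4:
  fixes a b c :: nat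
  assumes "a > 0" and "b > 0" and "c > 0"
    and "b = a + c \<or> (a = c \<and> b \<le> 2 * a)"
  shows "lie_mu (n_lie a b c :: ('k::field_char_0, 'k mat) lie_struct) = a + b + c"
proof (rule antisym)
  let ?L = "n_lie a b c :: ('k, 'k mat) lie_struct"
  let ?D = "{vectorspace.dim class_ring V | (V :: ('k, 'k vec) module) \<pi>. faithful_lie_representation ?L V \<pi>}"
  interpret W: vec_space "TYPE('k)" "a + b + c" .
  show "lie_mu ?L \<le> a + b + c"
    using lie_mu_le[OF natural_representation[of a b c, where 'k = 'k]] W.dim_is_n by simp
  have "?D \<noteq> {}" using natural_representation[of a b c, where 'k = 'k] by blast
  then have "lie_mu ?L \<in> ?D" unfolding lie_mu_def by (rule Inf_nat_def1)
  then obtain V :: "('k, 'k vec) module" and \<pi> where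
    V: "faithful_lie_representation ?L V \<pi>" "lie_mu ?L = vectorspace.dim class_ring V" by blast
  show "a + b + c \<le> lie_mu ?L" unfolding V(2) by (rule faithful_dim_ge[OF V(1) assms])
qed

end
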